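(* Let $(S_1,S_2,P)$ be a $\Gamma_3$-contraction on a Hilbert space $\mathcal H$. Then there are unique operators $F_1,F_2\in\mathcal B(\mathcal D_P)$ such that $S_1-S_2^*P=D_PF_1D_P$ and $S_2-S_1^*P=D_PF_2D_P$. Moreover, the numerical radius satisfies $\omega(F_1+F_2z)\le3$ for all $z\in\mathbb T$.
   Context: $\Gamma_3=\{(z_1+z_2+z_3,\,z_1z_2+z_2z_3+z_3z_1,\,z_1z_2z_3):|z_i|\le1\}\subset\mathbb C^3$. A commuting triple is a $\Gamma_3$-contraction if its Taylor joint spectrum lies in $\Gamma_3$ and $\|f(S_1,S_2,P)\|\le\sup_{\Gamma_3}|f|$ for all rational $f$ with poles off $\Gamma_3$. $D_P=(I-P^*P)^{1/2}$, $\mathcal D_P=\overline{\operatorname{Ran}}D_P$. $\omega(A)=\sup\{|\langle Ax,x\rangle|:\|x\|=1\}$. *)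

theory Defs
  imports "HOL-Analysis.Analysis"
begin

text \<open>A complex Hilbert space is encoded as a real Hilbert space (type class
real_inner + complete_space) together with a complex structure J
(multiplication by the imaginary unit): J is real-linear, J o J = -id and J is
orthogonal.  The complex inner product is recovered from the real one.\<close>

definition complex_structure :: "('a::real_inner \<Rightarrow> 'a) \<Rightarrow> bool" where
  "complex_structure J \<longleftrightarrow> linear J \<and> (\<forall>x. J (J x) = - x) \<and> (\<forall>x y. inner (J x) (J y) = inner x y)"

definition cscale :: "('a::real_vector \<Rightarrow> 'a) \<Rightarrow> complex \<Rightarrow> 'a \<Rightarrow> 'a" where
  "cscale J c x = Re c *\<^sub>R x + Im c *\<^sub>R J x"

text \<open>complex inner product, linear in the first argument\<close>
definition cinner :: "('a::real_inner \<Rightarrow> 'a) \<Rightarrow> 'a \<Rightarrow> 'a \<Rightarrow> complex" where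
  "cinner J x y = Complex (inner x y) (inner x (J y))"

definition cblinear :: "('a::real_normed_vector \<Rightarrow> 'a) \<Rightarrow> ('a \<Rightarrow> 'a) \<Rightarrow> bool" where
  "cblinear J A \<longleftrightarrow> bounded_linear A \<and> (\<forall>x. A (J x) = J (A x))"

text \<open>Operators in B(V) for a closed subspace V, represented by bounded operators on H
leaving V invariant (only their restriction to V matters)\<close>
definition op_on :: "('a::real_normed_vector \<Rightarrow> 'a) \<Rightarrow> 'a set \<Rightarrow> ('a \<Rightarrow> 'a) \<Rightarrow> bool" where
  "op_on J V F \<longleftrightarrow> cblinear J F \<and> F ` V \<subseteq> V"

text \<open>The adjoint of a bounded complex-linear operator coincides with its real adjoint
(library constant adjoint).  Positive square root of a positive operator:\<close>
definition op_sqrt :: "('a::real_inner \<Rightarrow> 'a) \<Rightarrow> ('a \<Rightarrow> 'a) \<Rightarrow> ('a \<Rightarrow> 'a)" where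
  "op_sqrt J T = (THE D. cblinear J D \<and> (\<forall>x y. inner (D x) y = inner x (D y))
                       \<and> (\<forall>x. 0 \<le> inner (D x) x) \<and> D \<circ> D = T)"

definition defect_op :: "('a::real_inner \<Rightarrow> 'a) \<Rightarrow> ('a \<Rightarrow> 'a) \<Rightarrow> ('a \<Rightarrow> 'a)" where
  "defect_op J P = op_sqrt J (\<lambda>x. x - adjoint P (P x))"

definition defect_space :: "('a::real_inner \<Rightarrow> 'a) \<Rightarrow> ('a \<Rightarrow> 'a) \<Rightarrow> 'a set" where
  "defect_space J P = closure (range (defect_op J P))"

text \<open>numerical radius of an operator A on the subspace V (0 for the zero space)\<close>
definition numerical_radius :: "('a::real_inner \<Rightarrow> 'a) \<Rightarrow> 'a set \<Rightarrow> ('a \<Rightarrow> 'a) \<Rightarrow> real" where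
  "numerical_radius J V A = Sup (insert 0 {cmod (cinner J (A x) x) | x. x \<in> V \<and> norm x = 1})"

definition Gamma3 :: "(complex \<times> complex \<times> complex) set" where
  "Gamma3 = {(z1 + z2 + z3, z1 * z2 + z2 * z3 + z3 * z1, z1 * z2 * z3) | z1 z2 z3.
               cmod z1 \<le> 1 \<and> cmod z2 \<le> 1 \<and> cmod z3 \<le> 1}"

text \<open>Taylor joint spectrum of a commuting triple (A,B,C) via the Koszul complex
  0 -> H -d1-> H^3 -d2-> H^3 -d3-> H -> 0.\<close>
definition koszul_exact :: "('a \<Rightarrow> 'a) \<Rightarrow> ('a \<Rightarrow> 'a) \<Rightarrow> ('a \<Rightarrow> 'a) \<Rightarrow> ('a::real_vector \<Rightarrow> 'a) \<Rightarrow> bool" where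
  "koszul_exact J A B C \<longleftrightarrow>
     (\<forall>x. A x = 0 \<and> B x = 0 \<and> C x = 0 \<longrightarrow> x = 0)
   \<and> (\<forall>x y z. B x - A y = 0 \<and> C x - A z = 0 \<and> C y - B z = 0 \<longrightarrow>
        (\<exists>w. x = A w \<and> y = B w \<and> z = C w))
   \<and> (\<forall>u v w. C u - B v + A w = 0 \<longrightarrow>
        (\<exists>x y z. u = B x - A y \<and> v = C x - A z \<and> w = C y - B z))
   \<and> (\<forall>t. \<exists>u v w. t = C u - B v + A w)"

definition taylor_spectrum :: "('a::real_vector \<Rightarrow> 'a) \<Rightarrow> ('a \<Rightarrow> 'a) \<Rightarrow> ('a \<Rightarrow> 'a) \<Rightarrow> ('a \<Rightarrow> 'a)
     \<Rightarrow> (complex \<times> complex \<times> complex) set" where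
  "taylor_spectrum J A B C = {(l1, l2, l3). \<not> koszul_exact J
      (\<lambda>x. A x - cscale J l1 x) (\<lambda>x. B x - cscale J l2 x) (\<lambda>x. C x - cscale J l3 x)}"

definition poly3 :: "(nat \<Rightarrow> nat \<Rightarrow> nat \<Rightarrow> complex) \<Rightarrow> bool" where
  "poly3 c \<longleftrightarrow> finite {(i, j, k). c i j k \<noteq> 0}"

definition poly3_eval :: "(nat \<Rightarrow> nat \<Rightarrow> nat \<Rightarrow> complex) \<Rightarrow> complex \<times> complex \<times> complex \<Rightarrow> complex" where
  "poly3_eval c z = (\<Sum>(i, j, k)\<in>{(i, j, k). c i j k \<noteq> 0}.
       c i j k * fst z ^ i * fst (snd z) ^ j * snd (snd z) ^ k)"

definition poly3_op :: "('a::real_vector \<Rightarrow> 'a) \<Rightarrow> (nat \<Rightarrow> nat \<Rightarrow> nat \<Rightarrow> complex)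
     \<Rightarrow> ('a \<Rightarrow> 'a) \<Rightarrow> ('a \<Rightarrow> 'a) \<Rightarrow> ('a \<Rightarrow> 'a) \<Rightarrow> ('a \<Rightarrow> 'a)" where
  "poly3_op J c A B C = (\<lambda>x. \<Sum>(i, j, k)\<in>{(i, j, k). c i j k \<noteq> 0}.
       cscale J (c i j k) ((A ^^ i) ((B ^^ j) ((C ^^ k) x))))"

definition op_inverse :: "('a::real_normed_vector \<Rightarrow> 'a) \<Rightarrow> ('a \<Rightarrow> 'a) \<Rightarrow> ('a \<Rightarrow> 'a)" where
  "op_inverse J Q = (THE R. cblinear J R \<and> R \<circ> Q = id \<and> Q \<circ> R = id)"

definition rat3_op :: "('a::real_normed_vector \<Rightarrow> 'a) \<Rightarrow> (nat \<Rightarrow> nat \<Rightarrow> nat \<Rightarrow> complex)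
     \<Rightarrow> (nat \<Rightarrow> nat \<Rightarrow> nat \<Rightarrow> complex) \<Rightarrow> ('a \<Rightarrow> 'a) \<Rightarrow> ('a \<Rightarrow> 'a) \<Rightarrow> ('a \<Rightarrow> 'a) \<Rightarrow> ('a \<Rightarrow> 'a)" where
  "rat3_op J p q A B C = poly3_op J p A B C \<circ> op_inverse J (poly3_op J q A B C)"

definition gamma3_contraction :: "('a::real_inner \<Rightarrow> 'a) \<Rightarrow> ('a \<Rightarrow> 'a) \<Rightarrow> ('a \<Rightarrow> 'a) \<Rightarrow> ('a \<Rightarrow> 'a) \<Rightarrow> bool" where
  "gamma3_contraction J S1 S2 P \<longleftrightarrow>
     cblinear J S1 \<and> cblinear J S2 \<and> cblinear J P
   \<and> S1 \<circ> S2 = S2 \<circ> S1 \<and> S1 \<circ> P = P \<circ> S1 \<and> S2 \<circ> P = P \<circ> S2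
   \<and> taylor_spectrum J S1 S2 P \<subseteq> Gamma3
   \<and> (\<forall>p q. poly3 p \<and> poly3 q \<and> (\<forall>z\<in>Gamma3. poly3_eval q z \<noteq> 0) \<longrightarrow>
        onorm (rat3_op J p q S1 S2 P) \<le> (SUP z\<in>Gamma3. cmod (poly3_eval p z / poly3_eval q z)))"

end

theory Submission
  imports Defs "HOL-Complex_Analysis.Conformal_Mappings"
begin

text \<open>
On the torus \<open>s\<^sub>2 = p s\<^sub>1\<^sup>*\<close> and \<open>s\<^sub>1 = p s\<^sub>2\<^sup>*\<close>, so \<open>(\<alpha>p - s\<^sub>2/3) / (1 - \<alpha>s\<^sub>1/3)\<close> and
\<open>(\<alpha>p - s\<^sub>1/3) / (1 - \<alpha>s\<^sub>2/3)\<close> are Blaschke quotients up to a unimodular factor, and by the maximum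
principle both are bounded by 1 on \<open>\<Gamma>\<^sub>3\<close> for \<open>\<bar>\<alpha>\<bar> < 1\<close>. The spectral set property turns this into
\<open>\<parallel>(\<alpha>P - S\<^sub>2/3)x\<parallel> \<le> \<parallel>(1 - \<alpha>S\<^sub>1/3)x\<parallel>\<close> and its mirror image, first for \<open>\<bar>\<alpha>\<bar> < 1\<close> and then on the circle.
Squaring and rotating \<open>\<alpha>\<close> gives
\<open>6\<bar>\<langle>(S\<^sub>1 - S\<^sub>2\<^sup>*P)x, x\<rangle>\<bar> \<le> 9\<parallel>D\<^sub>P x\<parallel>\<^sup>2 + \<parallel>S\<^sub>1x\<parallel>\<^sup>2 - \<parallel>S\<^sub>2x\<parallel>\<^sup>2\<close>
and its mirror image, and in the sum the last two terms cancel: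
\<open>\<bar>\<langle>(S\<^sub>1 - S\<^sub>2\<^sup>*P)x, x\<rangle>\<bar> + \<bar>\<langle>(S\<^sub>2 - S\<^sub>1\<^sup>*P)x, x\<rangle>\<bar> \<le> 3\<parallel>D\<^sub>P x\<parallel>\<^sup>2\<close>.
By polarization both sesquilinear forms are bounded with respect to \<open>\<parallel>D\<^sub>P x\<parallel> \<parallel>D\<^sub>P y\<parallel>\<close>, so they factor
through \<open>D\<^sub>P\<close>, and the displayed inequality is the numerical radius bound.
\<close>

section \<open>Quadratic inequalities and Cauchy sequences\<close>

lemma nonneg_quadratic_discriminant:
  fixes a b c :: real
  assumes "0 \<le> a" and nonneg: "\<And>t. 0 \<le> a * t\<^sup>2 + b * t + c"
  shows "b\<^sup>2 \<le> 4 * a * c"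
proof (cases "a = 0")
  case True
  have "b = 0"
  proof (rule ccontr)
    assume "b \<noteq> 0"
    then show False using nonneg[of "- (c + 1) / b"] True by simp
  qed
  with True show ?thesis by simp
next
  case False
  then have "a * (- b / (2 * a))\<^sup>2 + b * (- b / (2 * a)) + c = c - b\<^sup>2 / (4 * a)"
    by (simp add: power2_eq_square field_simps)
  then have "b\<^sup>2 / (4 * a) \<le> c" using nonneg[of "- b / (2 * a)"] by simp
  then show ?thesis using False \<open>0 \<le> a\<close> by (simp add: field_simps)
qed

lemma Cauchy_if_power2_dist_le_add:
  fixes X :: "nat \<Rightarrow> 'a::metric_space" and e :: "nat \<Rightarrow> real"
  assumes le: "\<And>m n. (dist (X m) (X n))\<^sup>2 \<le> e m + e n" and e: "e \<longlonglongrightarrow> 0"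
  shows "Cauchy X"
proof (rule metric_CauchyI)
  fix r :: real assume "0 < r"
  then have "eventually (\<lambda>n. e n < r\<^sup>2 / 2) sequentially" by (intro order_tendstoD(2)[OF e]) simp
  then obtain N where N: "\<And>n. N \<le> n \<Longrightarrow> e n < r\<^sup>2 / 2" by (auto simp: eventually_sequentially)
  have "dist (X m) (X n) < r" if "N \<le> m" "N \<le> n" for m n
  proof (rule power2_less_imp_less)
    show "(dist (X m) (X n))\<^sup>2 < r\<^sup>2" using le[of m n] N[OF that(1)] N[OF that(2)] by linarith
  qed (use \<open>0 < r\<close> in simp)
  then show "\<exists>N. \<forall>m\<ge>N. \<forall>n\<ge>N. dist (X m) (X n) < r" by blast
qed

lemma convergent_if_norm_increments_le:
  fixes X :: "nat \<Rightarrow> 'a::{real_normed_vector, complete_space}" and y :: "nat \<Rightarrow> real"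
  assumes step: "\<And>n. norm (X (Suc n) - X n) \<le> y (Suc n) - y n" and y: "convergent y"
  shows "convergent X"
proof (intro Cauchy_convergent metric_CauchyI)
  have increment: "norm (X (n + k) - X n) \<le> y (n + k) - y n" for n k
  proof (induction k)
    case (Suc k)
    then show ?case
      using norm_triangle_ineq[of "X (Suc (n + k)) - X (n + k)" "X (n + k) - X n"] step[of "n + k"]
      by simp
  qed simp
  fix r :: real assume "0 < r"
  then obtain N where N: "\<And>n. N \<le> n \<Longrightarrow> dist (y n) (y N) < r / 2"
    using metric_CauchyD[OF convergent_Cauchy[OF y], of "r / 2"] by auto
  have near: "dist (X n) (X N) < r / 2" if "N \<le> n" for n
    using increment[of N "n - N"] N[OF that] that by (simp add: dist_norm abs_if split: if_splits)
  have "dist (X m) (X n) < r" if "N \<le> m" "N \<le> n" for m n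
    by (rule dist_triangle_half_l[OF near[OF that(1)] near[OF that(2)]])
  then show "\<exists>N. \<forall>m\<ge>N. \<forall>n\<ge>N. dist (X m) (X n) < r" by blast
qed

section \<open>Riesz representation through a linear map\<close>

lemma subspace_closure:
  fixes S :: "'a::real_normed_vector set"
  assumes S: "subspace S"
  shows "subspace (closure S)"
proof (rule subspaceI)
  show "0 \<in> closure S" using subspace_0[OF S] closure_subset by blast
next
  fix x y assume "x \<in> closure S" "y \<in> closure S"
  moreover have "(\<lambda>(x, y). x + y) ` closure (S \<times> S) \<subseteq> closure S"
    using subspace_add[OF S] closure_subset[of S]
    by (intro image_closure_subset) (auto simp: case_prod_beta intro!: continuous_intros)
  ultimately show "x + y \<in> closure S" by (auto simp: closure_Times)
next
  fix c :: real and x assume "x \<in> closure S"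
  then have "c *\<^sub>R x \<in> closure ((\<lambda>x. c *\<^sub>R x) ` S)" unfolding closure_scaleR[symmetric] by (rule imageI)
  also have "\<dots> \<subseteq> closure S" by (intro closure_mono) (auto intro: subspace_scale[OF S])
  finally show "c *\<^sub>R x \<in> closure S" .
qed

lemma closure_range_eqI:
  fixes u v :: "'a::real_inner"
  assumes u: "u \<in> closure (range D)" and v: "v \<in> closure (range D)"
    and eq: "\<And>y. inner u (D y) = inner v (D y)"
  shows "u = v"
proof -
  have "closed {w. inner (u - v) w = 0}"
    by (intro closed_Collect_eq continuous_intros)
  then have "closure (range D) \<subseteq> {w. inner (u - v) w = 0}"
    by (intro closure_minimal) (auto simp: inner_diff_left eq)
  then have "inner (u - v) (u - v) = 0" using u v by (simp add: inner_diff_right subset_eq)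
  then show ?thesis by simp
qed

lemma norm_le_closure_rangeI:
  fixes u :: "'a::real_inner"
  assumes u: "u \<in> closure (range D)" and le: "\<And>y. inner u (D y) \<le> K * norm (D y)" and "0 \<le> K"
  shows "norm u \<le> K"
proof -
  have "closed {w. inner u w \<le> K * norm w}"
    by (intro closed_Collect_le continuous_intros)
  then have "closure (range D) \<subseteq> {w. inner u w \<le> K * norm w}"
    by (intro closure_minimal) (auto simp: le)
  then have "norm u * norm u \<le> K * norm u"
    using u by (auto simp: power2_norm_eq_inner simp flip: power2_eq_square)
  then show ?thesis using \<open>0 \<le> K\<close> by (cases "u = 0") auto
qed

definition riesz_energy :: "('b \<Rightarrow> 'a::real_inner) \<Rightarrow> ('b \<Rightarrow> real) \<Rightarrow> 'b \<Rightarrow> real" where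
  "riesz_energy D g y = (norm (D y))\<^sup>2 - 2 * g y"

lemma riesz_energy_minimizing_sequence:
  fixes D :: "'b \<Rightarrow> 'a::real_inner"
  assumes K: "\<And>y. \<bar>g y\<bar> \<le> K * norm (D y)"
  obtains m y where "\<And>z. m \<le> riesz_energy D g z"
    and "\<And>n. riesz_energy D g (y n) \<le> m + inverse (real (Suc n))"
proof -
  have "- K\<^sup>2 \<le> riesz_energy D g y" for y
  proof -
    have "0 \<le> (norm (D y) - K)\<^sup>2" by simp
    then show ?thesis
      using K[of y] unfolding riesz_energy_def by (simp add: power2_eq_square algebra_simps)
  qed
  then have bdd: "bdd_below (range (riesz_energy D g))" by (auto intro!: bdd_belowI2)
  define m where "m = Inf (range (riesz_energy D g))"
  have "\<exists>y. riesz_energy D g y \<le> m + inverse (real (Suc n))" for n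
    using cInf_lessD[of "range (riesz_energy D g)" "m + inverse (real (Suc n))"]
    by (force simp: m_def intro: less_imp_le)
  then obtain y where "\<And>n. riesz_energy D g (y n) \<le> m + inverse (real (Suc n))" by metis
  moreover have "m \<le> riesz_energy D g z" for z unfolding m_def by (rule cInf_lower[OF _ bdd]) simp
  ultimately show ?thesis using that by blast
qed

context
  fixes D :: "'b::real_vector \<Rightarrow> 'a::real_inner" and g :: "'b \<Rightarrow> real"
  assumes D: "linear D" and g: "linear g"
begin

lemma riesz_energy_midpoint:
  "(norm (D x - D y))\<^sup>2
    = 2 * riesz_energy D g x + 2 * riesz_energy D g y - 4 * riesz_energy D g ((1/2) *\<^sub>R (x + y))"
  unfolding riesz_energy_def
  by (simp add: linear_add[OF D] linear_add[OF g] linear_cmul[OF D] linear_cmul[OF g]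
      power2_norm_eq_inner inner_add inner_diff inner_commute field_simps)

lemma riesz_energy_add_scaleR:
  "riesz_energy D g (y + t *\<^sub>R x)
    = (norm (D x))\<^sup>2 * t\<^sup>2 + 2 * (inner (D y) (D x) - g x) * t + riesz_energy D g y"
  unfolding riesz_energy_def power2_norm_eq_inner
  by (simp add: linear_add[OF D] linear_add[OF g] linear_cmul[OF D] linear_cmul[OF g]
      inner_add inner_commute power2_eq_square algebra_simps)

lemma riesz_energy_near_minimum:
  assumes min: "\<And>z. m \<le> riesz_energy D g z" and near: "riesz_energy D g y \<le> m + e"
  shows "(inner (D y) (D x) - g x)\<^sup>2 \<le> (norm (D x))\<^sup>2 * e"
proof -
  have "0 \<le> (norm (D x))\<^sup>2 * t\<^sup>2 + 2 * (inner (D y) (D x) - g x) * t + e" for t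
    using min[of "y + t *\<^sub>R x"] near unfolding riesz_energy_add_scaleR by linarith
  then have "(2 * (inner (D y) (D x) - g x))\<^sup>2 \<le> 4 * (norm (D x))\<^sup>2 * e"
    by (intro nonneg_quadratic_discriminant) simp
  then show ?thesis by (simp only: power_mult_distrib) simp
qed

end

lemma riesz_closure_range:
  fixes D :: "'b::real_vector \<Rightarrow> 'a::{real_inner, complete_space}" and g :: "'b \<Rightarrow> real"
  assumes D: "linear D" and g: "linear g" and K: "\<And>y. \<bar>g y\<bar> \<le> K * norm (D y)" and "0 \<le> K"
  shows "\<exists>u\<in>closure (range D). norm u \<le> K \<and> (\<forall>y. inner u (D y) = g y)"
proof -
  obtain m y where min: "\<And>z. m \<le> riesz_energy D g z"
    and near: "\<And>n. riesz_energy D g (y n) \<le> m + inverse (real (Suc n))"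
    using riesz_energy_minimizing_sequence[where D = D and g = g, OF K] by blast
  have "Cauchy (\<lambda>n. D (y n))"
  proof (rule Cauchy_if_power2_dist_le_add)
    show "(dist (D (y i)) (D (y j)))\<^sup>2 \<le> 2 * inverse (real (Suc i)) + 2 * inverse (real (Suc j))" for i j
      using near[of i] near[of j] min[of "(1/2) *\<^sub>R (y i + y j)"]
      unfolding dist_norm riesz_energy_midpoint[OF D g] by linarith
  qed (rule tendsto_mult_right_zero[OF LIMSEQ_inverse_real_of_nat])
  then obtain u where u: "(\<lambda>n. D (y n)) \<longlonglongrightarrow> u" using Cauchy_convergent convergent_def by blast
  have "inner u (D x) = g x" for x
  proof -
    have "(\<lambda>n. (inner (D (y n)) (D x) - g x)\<^sup>2) \<longlonglongrightarrow> (inner u (D x) - g x)\<^sup>2"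
      by (intro tendsto_intros u)
    moreover have "(\<lambda>n. (norm (D x))\<^sup>2 * inverse (real (Suc n))) \<longlonglongrightarrow> 0"
      by (rule tendsto_mult_right_zero[OF LIMSEQ_inverse_real_of_nat])
    ultimately have "(inner u (D x) - g x)\<^sup>2 \<le> 0"
      using LIMSEQ_le riesz_energy_near_minimum[OF D g min near] by blast
    then show ?thesis by simp
  qed
  moreover from this have "inner u (D x) \<le> K * norm (D x)" for x using K[of x] by simp
  moreover have "u \<in> closure (range D)"
    unfolding closure_sequential by (intro exI[of _ "\<lambda>n. D (y n)"] conjI allI rangeI u)
  ultimately show ?thesis using norm_le_closure_rangeI[OF _ _ \<open>0 \<le> K\<close>] by blast
qed

lemma linear_riesz_closure_range:
  fixes D :: "'b::real_vector \<Rightarrow> 'a::{real_inner, complete_space}" and g :: "'c::real_vector \<Rightarrow> 'b \<Rightarrow> real"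
  assumes D: "linear D" and g_left: "\<And>y. linear (\<lambda>x. g x y)" and g_right: "\<And>x. linear (g x)"
    and K: "\<And>x y. \<bar>g x y\<bar> \<le> K x * norm (D y)" "\<And>x. 0 \<le> K x"
  obtains u where "linear u" and "\<And>x. u x \<in> closure (range D)"
    and "\<And>x y. inner (u x) (D y) = g x y" and "\<And>x. norm (u x) \<le> K x"
proof -
  have "\<exists>u. u \<in> closure (range D) \<and> norm u \<le> K x \<and> (\<forall>y. inner u (D y) = g x y)" for x
    using riesz_closure_range[OF D g_right K] by blast
  then obtain u where u: "\<And>x. u x \<in> closure (range D)" "\<And>x. norm (u x) \<le> K x"
    "\<And>x y. inner (u x) (D y) = g x y"
    by metis
  have V: "subspace (closure (range D))"
    by (intro subspace_closure linear_subspace_image[OF D subspace_UNIV])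
  have "linear u"
  proof (rule linearI)
    show "u (x + z) = u x + u z" for x z
      by (rule closure_range_eqI[where D = D])
        (auto simp: u subspace_add[OF V] inner_add_left linear_add[OF g_left])
    show "u (r *\<^sub>R x) = r *\<^sub>R u x" for r x
      by (rule closure_range_eqI[where D = D])
        (auto simp: u subspace_scale[OF V] linear_cmul[OF g_left])
  qed
  then show ?thesis using that u by blast
qed

section \<open>Adjoints on Hilbert spaces\<close>

context
  fixes A :: "'a::{real_inner, complete_space} \<Rightarrow> 'b::real_inner"
  assumes A: "bounded_linear A"
begin

lemma
  shows linear_adjoint: "linear (adjoint A)"
    and inner_adjoint_left: "inner (adjoint A y) x = inner y (A x)"
    and norm_adjoint_le: "norm (adjoint A y) \<le> onorm A * norm y"
proof -
  obtain u :: "'b \<Rightarrow> 'a" where u: "linear u" "\<And>x y. inner (u y) (id x) = inner y (A x)"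
    "\<And>y. norm (u y) \<le> onorm A * norm y"
  proof (rule linear_riesz_closure_range[of id "\<lambda>y x. inner y (A x)" "\<lambda>y. onorm A * norm y"])
    show "linear (\<lambda>y. inner y (A x))" for x
      by (rule bounded_linear.linear[OF bounded_linear_inner_left])
    show "linear (\<lambda>x. inner y (A x))" for y
      by (rule bounded_linear.linear[OF bounded_linear_compose[OF bounded_linear_inner_right A]])
    show "\<bar>inner y (A x)\<bar> \<le> onorm A * norm y * norm (id x)" for x y
      using Cauchy_Schwarz_ineq2[of y "A x"] mult_left_mono[OF onorm[OF A, of x] norm_ge_zero[of y]]
      by (simp add: ac_simps)
    show "0 \<le> onorm A * norm y" for y using onorm_pos_le[OF A] by simp
  qed (auto simp: linear_id)
  have "adjoint A = u" by (rule adjoint_unique) (use u(2) in \<open>simp add: inner_commute\<close>)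
  with u show "linear (adjoint A)" and "inner (adjoint A y) x = inner y (A x)"
    and "norm (adjoint A y) \<le> onorm A * norm y"
    by simp_all
qed

lemma inner_adjoint_right: "inner x (adjoint A y) = inner (A x) y"
  by (metis inner_adjoint_left inner_commute)

lemma bounded_linear_adjoint: "bounded_linear (adjoint A)"
  using norm_adjoint_le
  by (intro bounded_linear_intro[where K = "onorm A"])
    (simp_all add: linear_add[OF linear_adjoint] linear_cmul[OF linear_adjoint] mult.commute)

end

section \<open>Complex structures and complex-linear operators\<close>

lemma cblinearD:
  assumes "cblinear J A"
  shows "bounded_linear A" "linear A" "A (J x) = J (A x)"
  using assms by (auto simp: cblinear_def bounded_linear.linear)

lemma cblinear_ident: "cblinear J (\<lambda>x. x)"
  by (simp add: cblinear_def bounded_linear_ident)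

lemma cblinear_compose: "cblinear J A \<Longrightarrow> cblinear J B \<Longrightarrow> cblinear J (\<lambda>x. A (B x))"
  by (auto simp: cblinear_def intro: bounded_linear_compose)

lemma cinner_add_left: "cinner J (x + y) z = cinner J x z + cinner J y z"
  by (simp add: cinner_def complex_eq_iff inner_add_left)

lemma cinner_diff_left: "cinner J (x - y) z = cinner J x z - cinner J y z"
  by (simp add: cinner_def complex_eq_iff inner_diff_left)

lemma cinner_scaleR_left: "cinner J (r *\<^sub>R x) y = of_real r * cinner J x y"
  by (simp add: cinner_def complex_eq_iff)

lemma cscale_0_left [simp]: "cscale J 0 x = 0"
  by (simp add: cscale_def)

lemma cscale_1_left [simp]: "cscale J 1 x = x"
  by (simp add: cscale_def)

context
  fixes J :: "'a::real_inner \<Rightarrow> 'a"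
  assumes J: "complex_structure J"
begin

lemma linear_complex_structure: "linear J"
  using J by (simp add: complex_structure_def)

lemma complex_structure_involution: "J (J x) = - x"
  using J by (simp add: complex_structure_def)

lemma inner_complex_structure: "inner (J x) (J y) = inner x y"
  using J by (simp add: complex_structure_def)

lemma inner_complex_structure_left: "inner (J x) y = - inner x (J y)"
  using inner_complex_structure[of "J x" y] by (simp add: complex_structure_involution)

lemma norm_complex_structure: "norm (J x) = norm x"
  by (simp add: norm_eq_sqrt_inner inner_complex_structure)

lemma bounded_linear_complex_structure: "bounded_linear J"
  by (intro bounded_linear_intro[where K = 1])
    (simp_all add: linear_add[OF linear_complex_structure] linear_cmul[OF linear_complex_structure]
      norm_complex_structure)

lemma cblinear_add: "cblinear J A \<Longrightarrow> cblinear J B \<Longrightarrow> cblinear J (\<lambda>x. A x + B x)"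
  using linear_complex_structure by (auto simp: cblinear_def linear_add intro: bounded_linear_add)

lemma cblinear_diff: "cblinear J A \<Longrightarrow> cblinear J B \<Longrightarrow> cblinear J (\<lambda>x. A x - B x)"
  using linear_complex_structure by (auto simp: cblinear_def linear_diff intro: bounded_linear_sub)

lemma cblinear_cscale:
  assumes "cblinear J A"
  shows "cblinear J (\<lambda>x. cscale J c (A x))"
  using cblinearD[OF assms] bounded_linear_complex_structure
  by (auto simp: cblinear_def cscale_def linear_simps
      intro!: bounded_linear_add bounded_linear_compose[OF bounded_linear_scaleR_right]
        bounded_linear_compose[of J A])

lemma inner_cscale_left: "inner (cscale J c x) y = Re (c * cinner J x y)"
  by (simp add: cscale_def cinner_def inner_add_left inner_complex_structure_left)

lemma cinner_cscale_left: "cinner J (cscale J c x) y = c * cinner J x y"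
  by (simp add: cinner_def cscale_def complex_eq_iff inner_add_left inner_complex_structure
      inner_complex_structure_left[of x y])

lemma cinner_scaleR_right: "cinner J x (r *\<^sub>R y) = of_real r * cinner J x y"
  by (simp add: cinner_def complex_eq_iff linear_cmul[OF linear_complex_structure])

lemma norm_cscale: "norm (cscale J c x) = cmod c * norm x"
proof -
  have "inner x (J x) = 0" using inner_complex_structure_left[of x x] by (simp add: inner_commute)
  then have "(norm (cscale J c x))\<^sup>2 = (cmod c)\<^sup>2 * (norm x)\<^sup>2"
    by (simp add: cscale_def cmod_power2 power2_norm_eq_inner inner_add inner_commute
        inner_complex_structure)
      (simp add: power2_eq_square algebra_simps)
  then show ?thesis by (simp add: power2_eq_iff_nonneg flip: power_mult_distrib)
qed

lemma continuous_on_cinner [continuous_intros]: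
  assumes "continuous_on S f" "continuous_on S g"
  shows "continuous_on S (\<lambda>x. cinner J (f x) (g x))"
  unfolding cinner_def Complex_eq
  by (intro continuous_intros assms bounded_linear.continuous_on[OF bounded_linear_complex_structure])

end

lemma cblinear_adjoint:
  fixes A :: "'a::{real_inner, complete_space} \<Rightarrow> 'a"
  assumes J: "complex_structure J" and A: "cblinear J A"
  shows "cblinear J (adjoint A)"
proof -
  have "adjoint A (J y) = J (adjoint A y)" for y
    by (rule vector_eq_rdot[THEN iffD1])
      (simp add: inner_adjoint_left[OF cblinearD(1)[OF A]] inner_complex_structure_left[OF J]
        cblinearD(3)[OF A])
  then show ?thesis using bounded_linear_adjoint[OF cblinearD(1)[OF A]] by (simp add: cblinear_def)
qed

lemma cinner_adjoint_left:
  fixes A :: "'a::{real_inner, complete_space} \<Rightarrow> 'a"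
  assumes "cblinear J A"
  shows "cinner J (adjoint A y) x = cinner J y (A x)"
  using cblinearD[OF assms] by (simp add: cinner_def inner_adjoint_left)

section \<open>Square roots of positive operators\<close>

definition positive_op :: "('a::real_inner \<Rightarrow> 'a) \<Rightarrow> ('a \<Rightarrow> 'a) \<Rightarrow> bool" where
  "positive_op J D \<longleftrightarrow> cblinear J D \<and> (\<forall>x y. inner (D x) y = inner x (D y)) \<and> (\<forall>x. 0 \<le> inner (D x) x)"

lemma positive_opD:
  assumes "positive_op J D"
  shows "cblinear J D" "inner (D x) y = inner x (D y)" "0 \<le> inner (D x) x"
  using assms by (auto simp: positive_op_def)

lemma positive_op_kernel:
  assumes D: "positive_op J D" and "inner (D x) x = 0"
  shows "D x = 0"
proof -
  note lin = cblinearD(2)[OF positive_opD(1)[OF D]]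
  have "0 \<le> inner (D z) z * t\<^sup>2 + 2 * inner (D x) z * t + inner (D x) x" for z t
  proof -
    have "inner (D (x + t *\<^sub>R z)) (x + t *\<^sub>R z)
        = inner (D z) z * t\<^sup>2 + 2 * inner (D x) z * t + inner (D x) x"
      using positive_opD(2)[OF D, of x z]
      by (simp add: linear_add[OF lin] linear_cmul[OF lin] inner_add inner_commute power2_eq_square
          algebra_simps)
    then show ?thesis using positive_opD(3)[OF D, of "x + t *\<^sub>R z"] by simp
  qed
  then have "(2 * inner (D x) (D x))\<^sup>2 \<le> 4 * inner (D (D x)) (D x) * inner (D x) x"
    by (intro nonneg_quadratic_discriminant positive_opD(3)[OF D])
  then show ?thesis using assms(2) by simp
qed

lemma positive_op_sqrt_unique:
  assumes D: "positive_op J D" and E: "positive_op J E"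
    and comm: "\<And>x. D (E x) = E (D x)" and sq: "\<And>x. D (D x) = E (E x)"
  shows "D = E"
proof
  fix x
  define v where "v = D x - E x"
  have "D v + E v = 0"
    using cblinearD(2)[OF positive_opD(1)[OF D]] cblinearD(2)[OF positive_opD(1)[OF E]]
    by (simp add: v_def linear_diff comm sq)
  then have "inner (D v) v + inner (E v) v = 0" by (simp flip: inner_add_left)
  then have "inner (D v) v = 0" "inner (E v) v = 0"
    using positive_opD(3)[OF D, of v] positive_opD(3)[OF E, of v] by linarith+
  then have "D v = 0" "E v = 0" using positive_op_kernel D E by blast+
  moreover have "inner v v = inner x (D v) - inner x (E v)"
    by (subst (1) v_def) (simp add: inner_diff_left positive_opD(2)[OF D] positive_opD(2)[OF E])
  ultimately show "D x = E x" by (simp add: v_def)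
qed

text \<open>The fixed point \<open>L\<close> of \<open>X \<mapsto> (T + X\<^sup>2) / 2\<close> satisfies \<open>(1 - L)\<^sup>2 = 1 - T\<close>. For \<open>\<parallel>T\<parallel> \<le> 1\<close> the
  iterates and their increments are dominated by the scalar iterates for \<open>T = 1\<close>, which increase to 1.\<close>

primrec sqrt_iterate :: "('a::real_normed_vector \<Rightarrow>\<^sub>L 'a) \<Rightarrow> nat \<Rightarrow> ('a \<Rightarrow>\<^sub>L 'a)" where
  "sqrt_iterate T 0 = 0"
| "sqrt_iterate T (Suc n) = (1/2) *\<^sub>R (T + (sqrt_iterate T n o\<^sub>L sqrt_iterate T n))"

primrec sqrt_majorant :: "nat \<Rightarrow> real" where
  "sqrt_majorant 0 = 0"
| "sqrt_majorant (Suc n) = (1 + (sqrt_majorant n)\<^sup>2) / 2"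

definition sqrt_limit :: "('a::real_normed_vector \<Rightarrow>\<^sub>L 'a) \<Rightarrow> 'a \<Rightarrow> 'a" where
  "sqrt_limit T x = lim (\<lambda>n. sqrt_iterate T n x)"

lemma scaleR_2_sqrt_iterate_Suc:
  "2 *\<^sub>R sqrt_iterate T (Suc n) = T + (sqrt_iterate T n o\<^sub>L sqrt_iterate T n)"
  by simp

lemma sqrt_majorant_bounds: "0 \<le> sqrt_majorant n" "sqrt_majorant n \<le> 1"
proof -
  have "0 \<le> sqrt_majorant n \<and> sqrt_majorant n \<le> 1" by (induction n) (auto simp: power_le_one)
  then show "0 \<le> sqrt_majorant n" "sqrt_majorant n \<le> 1" by auto
qed

lemma sqrt_majorant_le_Suc: "sqrt_majorant n \<le> sqrt_majorant (Suc n)"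
proof -
  have "0 \<le> (1 - sqrt_majorant n)\<^sup>2" by simp
  then show ?thesis by (simp add: power2_eq_square algebra_simps)
qed

lemma convergent_sqrt_majorant: "convergent sqrt_majorant"
  using sqrt_majorant_bounds sqrt_majorant_le_Suc
  by (intro Bseq_mono_convergent BseqI'[where K = 1]) (auto intro: lift_Suc_mono_le)

context
  fixes T :: "'a::real_normed_vector \<Rightarrow>\<^sub>L 'a"
  assumes T: "norm T \<le> 1"
begin

lemma norm_sqrt_iterate_le: "norm (sqrt_iterate T n) \<le> sqrt_majorant n"
proof (induction n)
  case (Suc n)
  let ?X = "sqrt_iterate T n"
  have "norm (T + (?X o\<^sub>L ?X)) \<le> 1 + norm ?X * norm ?X"
    by (rule norm_triangle_mono[OF T norm_blinfun_compose])
  also have "\<dots> \<le> 1 + (sqrt_majorant n)\<^sup>2"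
    unfolding power2_eq_square by (intro add_left_mono mult_mono Suc sqrt_majorant_bounds norm_ge_zero)
  finally show ?case by simp
qed simp

lemma norm_sqrt_iterate_increment_le:
  "norm (sqrt_iterate T (Suc n) - sqrt_iterate T n) \<le> sqrt_majorant (Suc n) - sqrt_majorant n"
proof (induction n)
  case 0
  show ?case using T by simp
next
  case (Suc n)
  let ?X = "sqrt_iterate T (Suc n)" and ?Y = "sqrt_iterate T n"
    and ?x = "sqrt_majorant (Suc n)" and ?y = "sqrt_majorant n"
  have "norm ((?X o\<^sub>L (?X - ?Y)) + ((?X - ?Y) o\<^sub>L ?Y))
      \<le> norm ?X * norm (?X - ?Y) + norm (?X - ?Y) * norm ?Y"
    by (rule norm_triangle_mono[OF norm_blinfun_compose norm_blinfun_compose])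
  also have "\<dots> \<le> ?x * (?x - ?y) + (?x - ?y) * ?y"
    by (intro add_mono mult_mono Suc norm_sqrt_iterate_le order_trans[OF norm_ge_zero Suc] norm_ge_zero
        sqrt_majorant_bounds)
  also have "\<dots> = 2 * (sqrt_majorant (Suc (Suc n)) - ?x)"
    by (simp add: power2_eq_square field_simps)
  also have "(?X o\<^sub>L (?X - ?Y)) + ((?X - ?Y) o\<^sub>L ?Y) = (?X o\<^sub>L ?X) - (?Y o\<^sub>L ?Y)"
    by (simp only: bounded_bilinear.diff_left[OF bounded_bilinear_blinfun_compose]
        bounded_bilinear.diff_right[OF bounded_bilinear_blinfun_compose]) simp
  also have "\<dots> = 2 *\<^sub>R (sqrt_iterate T (Suc (Suc n)) - ?X)"
    by (simp only: scaleR_diff_right scaleR_2_sqrt_iterate_Suc) simp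
  finally show ?case by (simp del: sqrt_iterate.simps sqrt_majorant.simps)
qed

lemma norm_sqrt_iterate_apply_le: "norm (sqrt_iterate T n x) \<le> norm x"
  using norm_blinfun[of "sqrt_iterate T n" x] norm_sqrt_iterate_le[of n] sqrt_majorant_bounds(2)[of n]
    mult_right_mono[of "norm (sqrt_iterate T n)" 1 "norm x"] by simp

end

context
  fixes T :: "'a::{real_normed_vector, complete_space} \<Rightarrow>\<^sub>L 'a"
  assumes T: "norm T \<le> 1"
begin

lemma sqrt_iterate_tendsto: "(\<lambda>n. sqrt_iterate T n x) \<longlonglongrightarrow> sqrt_limit T x"
proof -
  have "convergent (\<lambda>n. sqrt_iterate T n x)"
  proof (rule convergent_if_norm_increments_le)
    show "norm (sqrt_iterate T (Suc n) x - sqrt_iterate T n x)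
        \<le> sqrt_majorant (Suc n) * norm x - sqrt_majorant n * norm x" for n
      unfolding left_diff_distrib[symmetric] blinfun.diff_left[symmetric]
      by (rule order_trans[OF norm_blinfun
            mult_right_mono[OF norm_sqrt_iterate_increment_le[OF T] norm_ge_zero]])
    show "convergent (\<lambda>n. sqrt_majorant n * norm x)"
      using convergent_sqrt_majorant by (intro convergent_mult convergent_const)
  qed
  then show ?thesis unfolding sqrt_limit_def by (rule convergent_LIMSEQ_iff[THEN iffD1])
qed

lemma norm_sqrt_limit_le: "norm (sqrt_limit T x) \<le> norm x"
  using norm_sqrt_iterate_apply_le[OF T]
  by (intro LIMSEQ_le_const2[OF tendsto_norm[OF sqrt_iterate_tendsto]]) auto

lemma bounded_linear_sqrt_limit: "bounded_linear (sqrt_limit T)"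
proof (rule bounded_linear_intro[where K = 1])
  show "sqrt_limit T (x + y) = sqrt_limit T x + sqrt_limit T y" for x y
    using LIMSEQ_unique[OF sqrt_iterate_tendsto[of "x + y"]]
      tendsto_add[OF sqrt_iterate_tendsto[of x] sqrt_iterate_tendsto[of y]]
    by (simp add: blinfun.add_right)
  show "sqrt_limit T (r *\<^sub>R x) = r *\<^sub>R sqrt_limit T x" for r x
    using LIMSEQ_unique[OF sqrt_iterate_tendsto[of "r *\<^sub>R x"]]
      tendsto_scaleR[OF tendsto_const[of r] sqrt_iterate_tendsto[of x]]
    by (simp add: blinfun.scaleR_right)
qed (simp add: norm_sqrt_limit_le)

lemma sqrt_limit_fixed_point: "2 *\<^sub>R sqrt_limit T x = T x + sqrt_limit T (sqrt_limit T x)"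
proof -
  have "(\<lambda>n. norm (sqrt_iterate T n x - sqrt_limit T x)) \<longlonglongrightarrow> 0"
    by (intro tendsto_norm_zero LIM_zero sqrt_iterate_tendsto)
  then have "(\<lambda>n. sqrt_iterate T n (sqrt_iterate T n x - sqrt_limit T x)) \<longlonglongrightarrow> 0"
    by (rule Lim_null_comparison[rotated]) (simp add: norm_sqrt_iterate_apply_le[OF T])
  from tendsto_add[OF this sqrt_iterate_tendsto[of "sqrt_limit T x"]]
  have "(\<lambda>n. T x + sqrt_iterate T n (sqrt_iterate T n x)) \<longlonglongrightarrow> T x + sqrt_limit T (sqrt_limit T x)"
    by (intro tendsto_intros) (simp add: blinfun.diff_right)
  then have "(\<lambda>n. 2 *\<^sub>R sqrt_iterate T (Suc n) x) \<longlonglongrightarrow> T x + sqrt_limit T (sqrt_limit T x)"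
    by (simp add: blinfun.add_left blinfun.scaleR_left)
  moreover have "(\<lambda>n. 2 *\<^sub>R sqrt_iterate T (Suc n) x) \<longlonglongrightarrow> 2 *\<^sub>R sqrt_limit T x"
    by (intro tendsto_intros LIMSEQ_Suc[OF sqrt_iterate_tendsto])
  ultimately show ?thesis using LIMSEQ_unique by blast
qed

lemma one_minus_sqrt_limit_squared:
  "(x - sqrt_limit T x) - sqrt_limit T (x - sqrt_limit T x) = x - T x"
proof -
  have "sqrt_limit T (x - sqrt_limit T x) = sqrt_limit T x - sqrt_limit T (sqrt_limit T x)"
    by (rule linear_diff[OF bounded_linear.linear[OF bounded_linear_sqrt_limit]])
  moreover have "T x = 2 *\<^sub>R sqrt_limit T x - sqrt_limit T (sqrt_limit T x)"
    by (simp add: sqrt_limit_fixed_point)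
  ultimately show ?thesis by (simp add: scaleR_2)
qed

lemma sqrt_limit_commute:
  assumes B: "bounded_linear B" and comm: "\<And>x. T (B x) = B (T x)"
  shows "sqrt_limit T (B x) = B (sqrt_limit T x)"
proof -
  have "sqrt_iterate T n (B x) = B (sqrt_iterate T n x)" for n x
    using B by (induction n arbitrary: x) (simp_all add: comm blinfun.bilinear_simps linear_simps)
  then show ?thesis
    using LIMSEQ_unique[OF sqrt_iterate_tendsto[of "B x"]]
      bounded_linear.tendsto[OF B sqrt_iterate_tendsto[of x]]
    by simp
qed

end

lemma sqrt_limit_selfadjoint:
  fixes T :: "'a::{real_inner, complete_space} \<Rightarrow>\<^sub>L 'a"
  assumes T: "norm T \<le> 1" and sym: "\<And>x y. inner (T x) y = inner x (T y)"
  shows "inner (sqrt_limit T x) y = inner x (sqrt_limit T y)"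
proof -
  have "inner (sqrt_iterate T n x) y = inner x (sqrt_iterate T n y)" for n x y
    by (induction n arbitrary: x y) (simp_all add: sym blinfun.bilinear_simps inner_add)
  then show ?thesis
    using LIMSEQ_unique[OF tendsto_inner[OF sqrt_iterate_tendsto[OF T, of x] tendsto_const[of y]]]
      tendsto_inner[OF tendsto_const[of x] sqrt_iterate_tendsto[OF T, of y]] by simp
qed

context
  fixes J :: "'a::{real_inner, complete_space} \<Rightarrow> 'a" and T :: "'a \<Rightarrow>\<^sub>L 'a"
  assumes J: "complex_structure J" and T: "norm T \<le> 1" "cblinear J T"
    and sym: "\<And>x y. inner (T x) y = inner x (T y)"
begin

lemma positive_op_one_minus_sqrt_limit: "positive_op J (\<lambda>x. x - sqrt_limit T x)"
  unfolding positive_op_def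
proof (intro conjI allI)
  have "cblinear J (sqrt_limit T)"
    using bounded_linear_sqrt_limit[OF T(1)]
      sqrt_limit_commute[OF T(1) bounded_linear_complex_structure[OF J] cblinearD(3)[OF T(2)]]
    by (simp add: cblinear_def)
  then show "cblinear J (\<lambda>x. x - sqrt_limit T x)" by (intro cblinear_diff[OF J] cblinear_ident)
  show "inner (x - sqrt_limit T x) y = inner x (y - sqrt_limit T y)" for x y
    by (simp add: inner_diff sqrt_limit_selfadjoint[OF T(1) sym])
  have "inner (sqrt_limit T x) x \<le> norm x * norm x" for x
    by (rule order_trans[OF norm_cauchy_schwarz
          mult_right_mono[OF norm_sqrt_limit_le[OF T(1)] norm_ge_zero]])
  then show "0 \<le> inner (x - sqrt_limit T x) x" for x
    by (simp add: inner_diff_left power2_norm_eq_inner flip: power2_eq_square)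
qed

lemma op_sqrt_one_minus: "op_sqrt J (\<lambda>x. x - T x) = (\<lambda>x. x - sqrt_limit T x)"
  unfolding op_sqrt_def
proof (rule the_equality, goal_cases)
  case 1
  show ?case
    using positive_op_one_minus_sqrt_limit
    by (auto simp: positive_op_def fun_eq_iff one_minus_sqrt_limit_squared[OF T(1)])
next
  case (2 E)
  then have E: "positive_op J E" and sq: "E (E x) = x - T x" for x
    unfolding positive_op_def comp_def by (blast, meson)
  note bE = cblinearD(1)[OF positive_opD(1)[OF E]]
  note E_diff = linear_diff[OF bounded_linear.linear[OF bE]]
  have "E (x - T x) = E x - T (E x)" for x using sq[of x] sq[of "E x"] by simp
  then have "T (E x) = E (T x)" for x by (simp add: E_diff)
  then have "sqrt_limit T (E x) = E (sqrt_limit T x)" for x by (rule sqrt_limit_commute[OF T(1) bE])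
  then show ?case
    by (intro positive_op_sqrt_unique[OF E positive_op_one_minus_sqrt_limit])
      (simp_all add: E_diff one_minus_sqrt_limit_squared[OF T(1)] sq)
qed

end

section \<open>The defect operator of a contraction\<close>

context
  fixes J P :: "'a::{real_inner, complete_space} \<Rightarrow> 'a"
  assumes J: "complex_structure J" and P: "cblinear J P" and contr: "\<And>x. norm (P x) \<le> norm x"
begin

lemma
  shows positive_op_defect_op: "positive_op J (defect_op J P)"
    and defect_op_squared: "defect_op J P (defect_op J P x) = x - adjoint P (P x)"
proof -
  note bP = cblinearD(1)[OF P]
  have cb: "cblinear J (\<lambda>x. adjoint P (P x))" by (rule cblinear_compose[OF cblinear_adjoint[OF J P] P])
  define T where "T = Blinfun (\<lambda>x. adjoint P (P x))"
  have T_apply: "blinfun_apply T = (\<lambda>x. adjoint P (P x))"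
    unfolding T_def by (rule bounded_linear_Blinfun_apply[OF cblinearD(1)[OF cb]])
  have "onorm P \<le> 1" by (rule onorm_bound) (simp_all add: contr)
  then have "norm (T x) \<le> 1 * norm x" for x
    unfolding T_apply
    using norm_adjoint_le[OF bP, of "P x"] contr[of x] mult_right_mono[of "onorm P" 1 "norm (P x)"]
    by simp
  then have T: "norm T \<le> 1" by (intro norm_blinfun_bound) auto
  have sym: "inner (T x) y = inner x (T y)" for x y
    by (simp add: T_apply inner_adjoint_left[OF bP] inner_adjoint_right[OF bP])
  have D: "defect_op J P = (\<lambda>x. x - sqrt_limit T x)"
    unfolding defect_op_def using op_sqrt_one_minus[OF J T _ sym] cb by (simp add: T_apply)
  show "positive_op J (defect_op J P)"
    unfolding D using positive_op_one_minus_sqrt_limit[OF J T _ sym] cb by (simp add: T_apply)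
  show "defect_op J P (defect_op J P x) = x - adjoint P (P x)"
    unfolding D one_minus_sqrt_limit_squared[OF T] T_apply ..
qed

lemma norm_defect_op_power2: "(norm (defect_op J P x))\<^sup>2 = (norm x)\<^sup>2 - (norm (P x))\<^sup>2"
proof -
  have "(norm (defect_op J P x))\<^sup>2 = inner x (x - adjoint P (P x))"
    by (simp add: power2_norm_eq_inner positive_opD(2)[OF positive_op_defect_op] defect_op_squared)
  then show ?thesis
    by (simp add: inner_diff_right inner_adjoint_right[OF cblinearD(1)[OF P]] power2_norm_eq_inner)
qed

end

section \<open>Pencil inequalities on the symmetrized tridisc\<close>

definition tridisc_holomorphic :: "(complex \<Rightarrow> complex \<Rightarrow> complex \<Rightarrow> complex) \<Rightarrow> bool" where
  "tridisc_holomorphic f \<longleftrightarrow> (\<forall>a\<in>cball 0 1. \<forall>b\<in>cball 0 1.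
     (\<lambda>z. f z a b) holomorphic_on cball 0 1 \<and> (\<lambda>z. f a z b) holomorphic_on cball 0 1
   \<and> (\<lambda>z. f a b z) holomorphic_on cball 0 1)"

lemma tridisc_holomorphicD:
  assumes "tridisc_holomorphic f" "cmod a \<le> 1" "cmod b \<le> 1"
  shows "(\<lambda>z. f z a b) holomorphic_on cball 0 1" "(\<lambda>z. f a z b) holomorphic_on cball 0 1"
    "(\<lambda>z. f a b z) holomorphic_on cball 0 1"
  using assms by (simp_all add: tridisc_holomorphic_def)

lemma maximum_modulus_disc:
  assumes hol: "f holomorphic_on cball 0 1" and circle: "\<And>z. cmod z = 1 \<Longrightarrow> cmod (f z) \<le> B"
    and z: "cmod z \<le> 1"
  shows "cmod (f z) \<le> B"
proof (rule maximum_modulus_frontier[of f "cball 0 1" B z])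
  show "f holomorphic_on interior (cball 0 1)" using hol by (rule holomorphic_on_subset) simp
  show "continuous_on (closure (cball 0 1)) f" using holomorphic_on_imp_continuous_on[OF hol] by simp
  show "cmod (f w) \<le> B" if "w \<in> frontier (cball 0 1)" for w using that by (intro circle) simp
qed (use z in simp_all)

lemma maximum_modulus_tridisc:
  assumes hol: "tridisc_holomorphic f"
    and torus: "\<And>u v w. cmod u = 1 \<Longrightarrow> cmod v = 1 \<Longrightarrow> cmod w = 1 \<Longrightarrow> cmod (f u v w) \<le> B"
    and z: "cmod z1 \<le> 1" "cmod z2 \<le> 1" "cmod z3 \<le> 1"
  shows "cmod (f z1 z2 z3) \<le> B"
proof (rule maximum_modulus_disc[OF tridisc_holomorphicD(3)[OF hol z(1,2)] _ z(3)])
  fix w assume w: "cmod w = 1"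
  show "cmod (f z1 z2 w) \<le> B"
  proof (rule maximum_modulus_disc[OF tridisc_holomorphicD(2)[OF hol z(1)] _ z(2)])
    fix v assume v: "cmod v = 1"
    show "cmod (f z1 v w) \<le> B"
      by (rule maximum_modulus_disc[OF tridisc_holomorphicD(1)[OF hol] _ z(1)])
        (simp_all add: torus v w)
  qed (simp add: w)
qed

lemma cmod_diff_cnj_le:
  assumes "cmod a \<le> 1" "cmod b \<le> 1"
  shows "cmod (a - cnj b) \<le> cmod (1 - a * b)"
proof -
  have "0 \<le> (1 - (cmod a)\<^sup>2) * (1 - (cmod b)\<^sup>2)"
    using assms by (intro mult_nonneg_nonneg) (auto simp: power_le_one)
  also have "\<dots> = (cmod (1 - a * b))\<^sup>2 - (cmod (a - cnj b))\<^sup>2"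
    unfolding cmod_power2 minus_complex.sel times_complex.sel one_complex.sel cnj.sel by algebra
  finally have "(cmod (a - cnj b))\<^sup>2 \<le> (cmod (1 - a * b))\<^sup>2" by linarith
  then show ?thesis by (rule power2_le_imp_le) (rule norm_ge_zero)
qed

lemma one_minus_mult_nonzero:
  fixes a b :: complex
  assumes "cmod a < 1" "cmod b \<le> 1"
  shows "1 - a * b \<noteq> 0"
proof
  assume "1 - a * b = 0"
  then have "cmod a * cmod b = 1" by (simp flip: norm_mult)
  then show False using assms mult_left_mono[of "cmod b" 1 "cmod a"] by simp
qed

text \<open>On the torus \<open>t = p s\<^sup>*\<close> makes \<open>(\<alpha>p - t) / (1 - \<alpha>s)\<close> the Blaschke quotient \<open>(\<alpha> - s\<^sup>*) / (1 - \<alpha>s)\<close>,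
  up to the unimodular factor \<open>p\<close>.\<close>

lemma tridisc_pencil_le:
  assumes hol: "tridisc_holomorphic p" "tridisc_holomorphic s" "tridisc_holomorphic t"
    and \<alpha>: "cmod \<alpha> < 1"
    and s: "\<And>u v w. cmod u \<le> 1 \<Longrightarrow> cmod v \<le> 1 \<Longrightarrow> cmod w \<le> 1 \<Longrightarrow> cmod (s u v w) \<le> 1"
    and torus: "\<And>u v w. cmod u = 1 \<Longrightarrow> cmod v = 1 \<Longrightarrow> cmod w = 1 \<Longrightarrow>
      cmod (p u v w) = 1 \<and> t u v w = p u v w * cnj (s u v w)"
    and z: "cmod z1 \<le> 1" "cmod z2 \<le> 1" "cmod z3 \<le> 1"
  shows "cmod (\<alpha> * p z1 z2 z3 - t z1 z2 z3) \<le> cmod (1 - \<alpha> * s z1 z2 z3)"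
proof -
  have quotient_hol: "tridisc_holomorphic (\<lambda>u v w. (\<alpha> * p u v w - t u v w) / (1 - \<alpha> * s u v w))"
    unfolding tridisc_holomorphic_def
    by (intro ballI conjI holomorphic_on_divide holomorphic_on_diff holomorphic_on_mult
        holomorphic_on_const hol[THEN tridisc_holomorphicD(1)] hol[THEN tridisc_holomorphicD(2)]
        hol[THEN tridisc_holomorphicD(3)]
        one_minus_mult_nonzero[OF \<alpha> s]) (simp_all only: mem_cball_0)
  have quotient_le_1: "cmod ((\<alpha> * p u v w - t u v w) / (1 - \<alpha> * s u v w)) \<le> 1
      \<longleftrightarrow> cmod (\<alpha> * p u v w - t u v w) \<le> cmod (1 - \<alpha> * s u v w)"
    if "cmod u \<le> 1" "cmod v \<le> 1" "cmod w \<le> 1" for u v w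
    using one_minus_mult_nonzero[OF \<alpha> s[OF that]] by (simp add: norm_divide)
  have "cmod (\<alpha> * p u v w - t u v w) \<le> cmod (1 - \<alpha> * s u v w)"
    if unit: "cmod u = 1" "cmod v = 1" "cmod w = 1" for u v w
  proof -
    have "\<alpha> * p u v w - t u v w = p u v w * (\<alpha> - cnj (s u v w))"
      using torus[OF unit] by (simp add: algebra_simps)
    then have "cmod (\<alpha> * p u v w - t u v w) = cmod (\<alpha> - cnj (s u v w))"
      using torus[OF unit] by (simp add: norm_mult)
    also have "\<dots> \<le> cmod (1 - \<alpha> * s u v w)" using \<alpha> s[of u v w] unit by (intro cmod_diff_cnj_le) simp_all
    finally show ?thesis .
  qed
  then have "cmod ((\<alpha> * p z1 z2 z3 - t z1 z2 z3) / (1 - \<alpha> * s z1 z2 z3)) \<le> 1"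
    by (intro maximum_modulus_tridisc[OF quotient_hol _ z]) (simp add: quotient_le_1)
  then show ?thesis using quotient_le_1[OF z] by blast
qed

lemma cmod_elementary_symmetric_le:
  assumes "cmod u \<le> 1" "cmod v \<le> 1" "cmod w \<le> 1"
  shows "cmod (u + v + w) \<le> 3" "cmod (u * v + v * w + w * u) \<le> 3" "cmod (u * v * w) \<le> 1"
proof -
  have sum: "cmod (a + b + c) \<le> 3" if "cmod a \<le> 1" "cmod b \<le> 1" "cmod c \<le> 1" for a b c :: complex
    using norm_triangle_ineq[of "a + b" c] norm_triangle_ineq[of a b] that by linarith
  have prod: "cmod (a * b) \<le> 1" if "cmod a \<le> 1" "cmod b \<le> 1" for a b :: complex
    using that by (simp add: norm_mult mult_le_one)
  show "cmod (u + v + w) \<le> 3" "cmod (u * v + v * w + w * u) \<le> 3" "cmod (u * v * w) \<le> 1"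
    by (intro sum prod assms)+
qed

lemma elementary_symmetric_torus:
  assumes "cmod u = 1" "cmod v = 1" "cmod w = 1"
  shows "u * v + v * w + w * u = u * v * w * cnj (u + v + w)"
    and "u + v + w = u * v * w * cnj (u * v + v * w + w * u)"
proof -
  have "u * cnj u = 1" "v * cnj v = 1" "w * cnj w = 1"
    using assms by (simp_all flip: complex_norm_square)
  then show "u * v + v * w + w * u = u * v * w * cnj (u + v + w)"
    and "u + v + w = u * v * w * cnj (u * v + v * w + w * u)"
    by (simp_all only: complex_cnj_add complex_cnj_mult) algebra+
qed

lemma Gamma3E:
  assumes "(s1, s2, p) \<in> Gamma3"
  obtains u v w where "s1 = u + v + w" "s2 = u * v + v * w + w * u" "p = u * v * w"
    and "cmod u \<le> 1" "cmod v \<le> 1" "cmod w \<le> 1"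
  using assms unfolding Gamma3_def by blast

lemma Gamma3_cmod_le:
  assumes "(s1, s2, p) \<in> Gamma3"
  shows "cmod s1 \<le> 3" "cmod s2 \<le> 3" "cmod p \<le> 1"
  using Gamma3E[OF assms] cmod_elementary_symmetric_le by metis+

lemma zero_in_Gamma3: "(0, 0, 0) \<in> Gamma3"
  unfolding Gamma3_def mem_Collect_eq by (intro exI[of _ 0]) simp

lemma Gamma3_pencil_le:
  assumes G: "(s1, s2, p) \<in> Gamma3" and \<alpha>: "cmod \<alpha> < 1"
  shows "cmod (\<alpha> * p - s2 / 3) \<le> cmod (1 - \<alpha> * (s1 / 3))"
    and "cmod (\<alpha> * p - s1 / 3) \<le> cmod (1 - \<alpha> * (s2 / 3))"
proof -
  obtain z1 z2 z3 where s: "s1 = z1 + z2 + z3" "s2 = z1 * z2 + z2 * z3 + z3 * z1" "p = z1 * z2 * z3"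
    and z: "cmod z1 \<le> 1" "cmod z2 \<le> 1" "cmod z3 \<le> 1"
    using Gamma3E[OF G] .
  have hol: "tridisc_holomorphic (\<lambda>u v w. (u + v + w) / 3)"
    "tridisc_holomorphic (\<lambda>u v w. (u * v + v * w + w * u) / 3)"
    "tridisc_holomorphic (\<lambda>u v w. u * v * w)"
    unfolding tridisc_holomorphic_def by (intro ballI conjI holomorphic_intros; simp)+
  have le1: "cmod ((u + v + w) / 3) \<le> 1" and le2: "cmod ((u * v + v * w + w * u) / 3) \<le> 1"
    if "cmod u \<le> 1" "cmod v \<le> 1" "cmod w \<le> 1" for u v w
    using cmod_elementary_symmetric_le[OF that] by (simp_all add: norm_divide)
  show "cmod (\<alpha> * p - s2 / 3) \<le> cmod (1 - \<alpha> * (s1 / 3))"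
    unfolding s
  proof (rule tridisc_pencil_le[where p = "\<lambda>u v w. u * v * w" and s = "\<lambda>u v w. (u + v + w) / 3"
        and t = "\<lambda>u v w. (u * v + v * w + w * u) / 3", OF hol(3,1,2) \<alpha> le1 _ z])
    show "cmod (u * v * w) = 1 \<and> (u * v + v * w + w * u) / 3 = u * v * w * cnj ((u + v + w) / 3)"
      if "cmod u = 1" "cmod v = 1" "cmod w = 1" for u v w
      using elementary_symmetric_torus(1)[OF that] that by (simp add: norm_mult)
  qed
  show "cmod (\<alpha> * p - s1 / 3) \<le> cmod (1 - \<alpha> * (s2 / 3))"
    unfolding s
  proof (rule tridisc_pencil_le[where p = "\<lambda>u v w. u * v * w" and t = "\<lambda>u v w. (u + v + w) / 3"
        and s = "\<lambda>u v w. (u * v + v * w + w * u) / 3", OF hol(3,2,1) \<alpha> le2 _ z])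
    show "cmod (u * v * w) = 1 \<and> (u + v + w) / 3 = u * v * w * cnj ((u * v + v * w + w * u) / 3)"
      if "cmod u = 1" "cmod v = 1" "cmod w = 1" for u v w
      using elementary_symmetric_torus(2)[OF that] that by (simp add: norm_mult)
  qed
qed

section \<open>The spectral set inequality for affine pencils\<close>

definition affine3 :: "complex \<Rightarrow> complex \<Rightarrow> complex \<Rightarrow> complex \<Rightarrow> nat \<Rightarrow> nat \<Rightarrow> nat \<Rightarrow> complex" where
  "affine3 a b c d i j k = (if (i, j, k) = (0, 0, 0) then a else if (i, j, k) = (1, 0, 0) then b
     else if (i, j, k) = (0, 1, 0) then c else if (i, j, k) = (0, 0, 1) then d else 0)"

lemma affine3_support:
  "{(i, j, k). affine3 a b c d i j k \<noteq> 0} \<subseteq> {(0, 0, 0), (1, 0, 0), (0, 1, 0), (0, 0, 1)}"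
  by (auto simp: affine3_def split: if_splits)

lemma poly3_affine3: "poly3 (affine3 a b c d)"
  unfolding poly3_def by (rule finite_subset[OF affine3_support]) simp

lemma sum_affine3_support:
  assumes "\<And>i j k. f 0 i j k = 0"
  shows "(\<Sum>(i, j, k)\<in>{(i, j, k). affine3 a b c d i j k \<noteq> 0}. f (affine3 a b c d i j k) i j k)
    = f a 0 0 0 + f b 1 0 0 + f c 0 1 0 + (f d 0 0 1 :: 'a::comm_monoid_add)"
proof -
  have "(\<Sum>(i, j, k)\<in>{(i, j, k). affine3 a b c d i j k \<noteq> 0}. f (affine3 a b c d i j k) i j k)
    = (\<Sum>(i, j, k)\<in>{(0, 0, 0), (1, 0, 0), (0, 1, 0), (0, 0, 1)}. f (affine3 a b c d i j k) i j k)"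
    by (intro sum.mono_neutral_cong_left affine3_support) (auto simp: assms)
  then show ?thesis by (simp add: affine3_def add.assoc)
qed

lemma poly3_eval_affine3: "poly3_eval (affine3 a b c d) (s1, s2, p) = a + b * s1 + c * s2 + d * p"
  unfolding poly3_eval_def by (subst sum_affine3_support) simp_all

lemma poly3_op_affine3:
  "poly3_op J (affine3 a b c d) A B C
    = (\<lambda>x. cscale J a x + cscale J b (A x) + cscale J c (B x) + cscale J d (C x))"
  unfolding poly3_op_def by (subst sum_affine3_support) simp_all

lemma cblinear_poly3_op_affine3:
  assumes "complex_structure J" and "cblinear J A" "cblinear J B" "cblinear J C"
  shows "cblinear J (poly3_op J (affine3 a b c d) A B C)"
  unfolding poly3_op_affine3 by (intro cblinear_add cblinear_cscale cblinear_ident assms)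

lemma op_inverse_eq:
  assumes "cblinear J R" "R \<circ> Q = id" "Q \<circ> R = id"
  shows "op_inverse J Q = R"
  unfolding op_inverse_def
proof (rule the_equality)
  fix R' assume R': "cblinear J R' \<and> R' \<circ> Q = id \<and> Q \<circ> R' = id"
  then have "R' \<circ> (Q \<circ> R) = R" by (simp add: comp_assoc[symmetric])
  then show "R' = R" using assms by simp
qed (use assms in auto)

lemma gamma3_contraction_norm_le:
  fixes S1 :: "'a::real_inner \<Rightarrow> 'a"
  assumes G: "gamma3_contraction J S1 S2 P" and pq: "poly3 p" "poly3 q"
    and q0: "\<And>z. z \<in> Gamma3 \<Longrightarrow> poly3_eval q z \<noteq> 0"
    and le: "\<And>z. z \<in> Gamma3 \<Longrightarrow> cmod (poly3_eval p z) \<le> M * cmod (poly3_eval q z)"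
    and p: "cblinear J (poly3_op J p S1 S2 P)"
    and R: "cblinear J R" "R \<circ> poly3_op J q S1 S2 P = id" "poly3_op J q S1 S2 P \<circ> R = id"
  shows "norm (poly3_op J p S1 S2 P x) \<le> M * norm (poly3_op J q S1 S2 P x)"
proof -
  let ?p = "poly3_op J p S1 S2 P" and ?q = "poly3_op J q S1 S2 P"
  have rat: "rat3_op J p q S1 S2 P = ?p \<circ> R"
    unfolding rat3_op_def by (simp add: op_inverse_eq[OF R])
  have "onorm (?p \<circ> R) \<le> (SUP z\<in>Gamma3. cmod (poly3_eval p z / poly3_eval q z))"
    using G pq q0 unfolding gamma3_contraction_def rat[symmetric] by blast
  also have "\<dots> \<le> M"
    using q0 le zero_in_Gamma3 by (intro cSUP_least) (auto simp: norm_divide divide_le_eq)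
  finally have onorm_le: "onorm (?p \<circ> R) \<le> M" .
  have bl: "bounded_linear (?p \<circ> R)"
    unfolding comp_def by (rule bounded_linear_compose[OF cblinearD(1)[OF p] cblinearD(1)[OF R(1)]])
  have "norm (?p x) = norm ((?p \<circ> R) (?q x))" using fun_cong[OF R(2), of x] by simp
  also have "\<dots> \<le> onorm (?p \<circ> R) * norm (?q x)" by (rule onorm[OF bl])
  also have "\<dots> \<le> M * norm (?q x)" by (rule mult_right_mono[OF onorm_le norm_ge_zero])
  finally show ?thesis .
qed

lemma gamma3_contractionD:
  assumes "gamma3_contraction J S1 S2 P"
  shows "cblinear J S1" "cblinear J S2" "cblinear J P"
  using assms by (simp_all add: gamma3_contraction_def)

lemma gamma3_contraction_affine_le:
  fixes S1 :: "'a::real_inner \<Rightarrow> 'a"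
  assumes J: "complex_structure J" and G: "gamma3_contraction J S1 S2 P"
    and le: "\<And>s1 s2 p. (s1, s2, p) \<in> Gamma3 \<Longrightarrow> cmod (a + b * s1 + c * s2 + d * p) \<le> M"
  shows "norm (poly3_op J (affine3 a b c d) S1 S2 P x) \<le> M * norm x"
proof -
  have one: "poly3_op J (affine3 1 0 0 0) S1 S2 P = id"
    by (simp add: poly3_op_affine3 fun_eq_iff)
  have "norm (poly3_op J (affine3 a b c d) S1 S2 P x)
      \<le> M * norm (poly3_op J (affine3 1 0 0 0) S1 S2 P x)"
  proof (rule gamma3_contraction_norm_le[OF G poly3_affine3 poly3_affine3])
    show "cblinear J (poly3_op J (affine3 a b c d) S1 S2 P)"
      by (intro cblinear_poly3_op_affine3 J gamma3_contractionD[OF G])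
    show "cblinear J id" using cblinear_ident by (simp add: id_def)
  qed (use le in \<open>auto simp: one poly3_eval_affine3\<close>)
  then show ?thesis by (simp add: one)
qed

lemma gamma3_contraction_norm_P_le:
  assumes J: "complex_structure J" and G: "gamma3_contraction J S1 S2 P"
  shows "norm (P x) \<le> norm x"
  using gamma3_contraction_affine_le[OF J G, of 0 0 0 1 1 x] Gamma3_cmod_le(3)
  by (simp add: poly3_op_affine3)

lemma bij_ident_plus_contraction:
  fixes K :: "'a::{real_normed_vector, complete_space} \<Rightarrow> 'a"
  assumes K: "linear K" and le: "\<And>x. norm (K x) \<le> k * norm x" and k: "0 \<le> k" "k < 1"
  shows "bij (\<lambda>x. x + K x)"
  unfolding bij_iff
proof
  fix y
  have "\<exists>!x. y - K x = x"
  proof (rule banach_fix_type[OF k])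
    have "dist (y - K x) (y - K z) \<le> k * dist x z" for x z
      using le[of "z - x"] by (simp add: dist_norm norm_minus_commute linear_diff[OF K])
    then show "\<forall>x z. dist (y - K x) (y - K z) \<le> k * dist x z" by blast
  qed
  moreover have "y - K x = x \<longleftrightarrow> x + K x = y" for x by (auto simp: algebra_simps)
  ultimately show "\<exists>!x. x + K x = y" by simp
qed

lemma cblinear_inverse_ident_plus:
  fixes K :: "'a::{real_inner, complete_space} \<Rightarrow> 'a"
  assumes J: "complex_structure J" and K: "cblinear J K"
    and le: "\<And>x. norm (K x) \<le> k * norm x" and k: "0 \<le> k" "k < 1"
  obtains R where "cblinear J R" "R \<circ> (\<lambda>x. x + K x) = id" "(\<lambda>x. x + K x) \<circ> R = id"
proof -
  define Q where "Q x = x + K x" for x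
  have Q: "cblinear J Q" unfolding Q_def by (intro cblinear_add J K cblinear_ident)
  have bij: "bij Q" unfolding Q_def by (rule bij_ident_plus_contraction[OF cblinearD(2)[OF K] le k])
  then have inverse: "inv Q (Q x) = x" "Q (inv Q x) = x" for x
    by (simp_all add: bij_is_inj bij_is_surj surj_f_inv_f)
  have low: "(1 - k) * norm x \<le> norm (Q x)" for x
    using norm_triangle_ineq2[of x "- K x"] le[of x] by (simp add: Q_def algebra_simps)
  have "bounded_linear (inv Q)"
  proof (rule bounded_linear_intro[where K = "1 / (1 - k)"])
    show "inv Q (x + y) = inv Q x + inv Q y" for x y
      by (metis inverse linear_add[OF cblinearD(2)[OF Q]])
    show "inv Q (r *\<^sub>R x) = r *\<^sub>R inv Q x" for r x
      by (metis inverse linear_cmul[OF cblinearD(2)[OF Q]])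
    show "norm (inv Q y) \<le> norm y * (1 / (1 - k))" for y
      using low[of "inv Q y"] k by (simp add: inverse field_simps)
  qed
  moreover have "inv Q (J y) = J (inv Q y)" for y
    using cblinearD(3)[OF Q, of "inv Q y"] by (metis inverse)
  ultimately have "cblinear J (inv Q)" by (simp add: cblinear_def)
  then show ?thesis
    using that inverse unfolding Q_def[abs_def, symmetric] by (auto simp: fun_eq_iff)
qed

lemma gamma3_contraction_affine_dominated:
  fixes S1 :: "'a::{real_inner, complete_space} \<Rightarrow> 'a"
  assumes J: "complex_structure J" and G: "gamma3_contraction J S1 S2 P"
    and small: "\<And>s1 s2 p. (s1, s2, p) \<in> Gamma3 \<Longrightarrow> cmod (b * s1 + c * s2 + d * p) \<le> k" and "k < 1"
    and dom: "\<And>s1 s2 p. (s1, s2, p) \<in> Gamma3 \<Longrightarrow>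
      cmod (a' + b' * s1 + c' * s2 + d' * p) \<le> cmod (1 + b * s1 + c * s2 + d * p)"
  shows "norm (poly3_op J (affine3 a' b' c' d') S1 S2 P x)
    \<le> norm (poly3_op J (affine3 1 b c d) S1 S2 P x)"
proof -
  note cb = cblinear_poly3_op_affine3[OF J gamma3_contractionD[OF G]]
  have "0 \<le> k" using small[OF zero_in_Gamma3] by simp
  have "norm (poly3_op J (affine3 0 b c d) S1 S2 P x) \<le> k * norm x" for x
    using small by (intro gamma3_contraction_affine_le[OF J G]) simp
  then obtain R where R: "cblinear J R" "R \<circ> poly3_op J (affine3 1 b c d) S1 S2 P = id"
    "poly3_op J (affine3 1 b c d) S1 S2 P \<circ> R = id"
    using cblinear_inverse_ident_plus[OF J cb[of 0 b c d] _ \<open>0 \<le> k\<close> \<open>k < 1\<close>]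
    by (auto simp: poly3_op_affine3 add.assoc)
  have nonzero: "1 + b * s1 + c * s2 + d * p \<noteq> 0" if "(s1, s2, p) \<in> Gamma3" for s1 s2 p
  proof
    assume "1 + b * s1 + c * s2 + d * p = 0"
    then have "b * s1 + c * s2 + d * p = - 1" by (simp add: algebra_simps eq_neg_iff_add_eq_0)
    then show False using small[OF that] \<open>k < 1\<close> by simp
  qed
  have "norm (poly3_op J (affine3 a' b' c' d') S1 S2 P x)
      \<le> 1 * norm (poly3_op J (affine3 1 b c d) S1 S2 P x)"
    using nonzero dom
    by (intro gamma3_contraction_norm_le[OF G poly3_affine3 poly3_affine3 _ _ cb R])
      (auto simp: poly3_eval_affine3)
  then show ?thesis by simp
qed

text \<open>Strictly inside the disc the denominators \<open>1 - \<alpha>s\<^sub>i/3\<close> are invertible; the circle follows by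
  continuity in \<open>\<alpha>\<close>.\<close>

lemma gamma3_contraction_pencil_open_disc:
  fixes S1 :: "'a::{real_inner, complete_space} \<Rightarrow> 'a"
  assumes J: "complex_structure J" and G: "gamma3_contraction J S1 S2 P" and \<alpha>: "cmod \<alpha> < 1"
  shows "norm (cscale J \<alpha> (P x) - (1/3) *\<^sub>R S2 x) \<le> norm (x - cscale J \<alpha> ((1/3) *\<^sub>R S1 x))"
    and "norm (cscale J \<alpha> (P x) - (1/3) *\<^sub>R S1 x) \<le> norm (x - cscale J \<alpha> ((1/3) *\<^sub>R S2 x))"
proof -
  have scale: "cscale J (- (\<alpha> / 3)) y = - cscale J \<alpha> ((1/3) *\<^sub>R y)"
    "cscale J (- (1/3)) y = - ((1/3) *\<^sub>R y)" for y
    using linear_complex_structure[OF J] by (simp_all add: cscale_def linear_cmul)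
  have small: "cmod (\<alpha> / 3 * s) \<le> cmod \<alpha>" if "cmod s \<le> 3" for s
    using mult_left_mono[OF that, of "cmod \<alpha>"] by (simp add: norm_mult norm_divide)
  have "norm (poly3_op J (affine3 0 0 (- (1/3)) \<alpha>) S1 S2 P x)
      \<le> norm (poly3_op J (affine3 1 (- (\<alpha> / 3)) 0 0) S1 S2 P x)"
  proof (rule gamma3_contraction_affine_dominated[OF J G _ \<alpha>])
    fix s1 s2 p assume s: "(s1, s2, p) \<in> Gamma3"
    show "cmod (- (\<alpha> / 3) * s1 + 0 * s2 + 0 * p) \<le> cmod \<alpha>"
      using small[OF Gamma3_cmod_le(1)[OF s]] by simp
    show "cmod (0 + 0 * s1 + - (1/3) * s2 + \<alpha> * p) \<le> cmod (1 + - (\<alpha> / 3) * s1 + 0 * s2 + 0 * p)"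
      using Gamma3_pencil_le(1)[OF s \<alpha>] by simp
  qed
  then show "norm (cscale J \<alpha> (P x) - (1/3) *\<^sub>R S2 x) \<le> norm (x - cscale J \<alpha> ((1/3) *\<^sub>R S1 x))"
    by (simp add: poly3_op_affine3 scale)
  have "norm (poly3_op J (affine3 0 (- (1/3)) 0 \<alpha>) S1 S2 P x)
      \<le> norm (poly3_op J (affine3 1 0 (- (\<alpha> / 3)) 0) S1 S2 P x)"
  proof (rule gamma3_contraction_affine_dominated[OF J G _ \<alpha>])
    fix s1 s2 p assume s: "(s1, s2, p) \<in> Gamma3"
    show "cmod (0 * s1 + - (\<alpha> / 3) * s2 + 0 * p) \<le> cmod \<alpha>"
      using small[OF Gamma3_cmod_le(2)[OF s]] by simp
    show "cmod (0 + - (1/3) * s1 + 0 * s2 + \<alpha> * p) \<le> cmod (1 + 0 * s1 + - (\<alpha> / 3) * s2 + 0 * p)"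
      using Gamma3_pencil_le(2)[OF s \<alpha>] by simp
  qed
  then show "norm (cscale J \<alpha> (P x) - (1/3) *\<^sub>R S1 x) \<le> norm (x - cscale J \<alpha> ((1/3) *\<^sub>R S2 x))"
    by (simp add: poly3_op_affine3 scale)
qed

lemma cscale_pencil_closed_disc:
  fixes J :: "'a::real_normed_vector \<Rightarrow> 'a"
  assumes open_disc: "\<And>\<alpha>. cmod \<alpha> < 1 \<Longrightarrow> norm (cscale J \<alpha> p - b) \<le> norm (x - cscale J \<alpha> a)"
    and \<alpha>: "cmod \<alpha> \<le> 1"
  shows "norm (cscale J \<alpha> p - b) \<le> norm (x - cscale J \<alpha> a)"
proof -
  have "closed {\<alpha>. norm (cscale J \<alpha> p - b) \<le> norm (x - cscale J \<alpha> a)}"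
    unfolding cscale_def by (intro closed_Collect_le continuous_intros)
  then have "closure (ball 0 1) \<subseteq> {\<alpha>. norm (cscale J \<alpha> p - b) \<le> norm (x - cscale J \<alpha> a)}"
    by (intro closure_minimal) (auto intro: open_disc)
  then show ?thesis using \<alpha> by auto
qed

section \<open>The quadratic forms of the fundamental operators\<close>

lemma ex_unimodular_rotation: "\<exists>w. cmod w = 1 \<and> Re (u * w) = cmod u"
proof (cases "u = 0")
  case False
  have "u * (cnj u / of_real (cmod u)) = of_real (cmod u)"
    using False complex_norm_square[of u] by (simp add: field_simps power2_eq_square)
  then show ?thesis using False
    by (intro exI[of _ "cnj u / of_real (cmod u)"]) (simp add: norm_divide)
qed (auto intro: exI[of _ 1])

lemma cmod_cinner_diff_le_of_pencil:
  fixes a b p x :: "'a::real_inner"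
  assumes J: "complex_structure J"
    and pencil: "\<And>\<beta>. cmod \<beta> = 1 \<Longrightarrow> norm (cscale J \<beta> p - b) \<le> norm (x - cscale J \<beta> a)"
  shows "2 * cmod (cinner J a x - cinner J p b) \<le> (norm x)\<^sup>2 - (norm p)\<^sup>2 + (norm a)\<^sup>2 - (norm b)\<^sup>2"
proof -
  have expand: "(norm (u - v))\<^sup>2 = (norm u)\<^sup>2 - 2 * inner u v + (norm v)\<^sup>2" for u v :: 'a
    by (simp add: power2_norm_eq_inner inner_diff inner_commute)
  obtain \<beta> where \<beta>: "cmod \<beta> = 1"
    "Re ((cinner J a x - cinner J p b) * \<beta>) = cmod (cinner J a x - cinner J p b)"
    using ex_unimodular_rotation by blast
  have "(norm (cscale J \<beta> p - b))\<^sup>2 \<le> (norm (x - cscale J \<beta> a))\<^sup>2"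
    by (intro power_mono pencil \<beta>(1) norm_ge_zero)
  then have "(norm p)\<^sup>2 - 2 * Re (\<beta> * cinner J p b) + (norm b)\<^sup>2
      \<le> (norm x)\<^sup>2 - 2 * Re (\<beta> * cinner J a x) + (norm a)\<^sup>2"
    unfolding expand inner_commute[of x] inner_cscale_left[OF J] norm_cscale[OF J] \<beta>(1) by simp
  moreover have "cmod (cinner J a x - cinner J p b) = Re (\<beta> * cinner J a x) - Re (\<beta> * cinner J p b)"
    unfolding \<beta>(2)[symmetric] by (simp add: algebra_simps)
  ultimately show ?thesis by linarith
qed

lemma gamma3_contraction_form_le:
  fixes S1 :: "'a::{real_inner, complete_space} \<Rightarrow> 'a"
  assumes J: "complex_structure J" and G: "gamma3_contraction J S1 S2 P"
  shows "cmod (cinner J (S1 x - adjoint S2 (P x)) x) + cmod (cinner J (S2 x - adjoint S1 (P x)) x)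
    \<le> 3 * ((norm x)\<^sup>2 - (norm (P x))\<^sup>2)"
proof -
  have form: "6 * cmod (cinner J (S x - adjoint T (P x)) x)
      \<le> 9 * ((norm x)\<^sup>2 - (norm (P x))\<^sup>2) + (norm (S x))\<^sup>2 - (norm (T x))\<^sup>2"
    if T: "cblinear J T"
      and pencil: "\<And>\<alpha>. cmod \<alpha> < 1 \<Longrightarrow>
        norm (cscale J \<alpha> (P x) - (1/3) *\<^sub>R T x) \<le> norm (x - cscale J \<alpha> ((1/3) *\<^sub>R S x))" for S T
  proof -
    have third: "cinner J ((1/3) *\<^sub>R S x) x - cinner J (P x) ((1/3) *\<^sub>R T x)
        = (1/3) * cinner J (S x - adjoint T (P x)) x"
      unfolding cinner_diff_left cinner_adjoint_left[OF T] cinner_scaleR_left cinner_scaleR_right[OF J]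
      by (simp add: right_diff_distrib)
    have "2 * cmod ((1/3) * cinner J (S x - adjoint T (P x)) x)
        \<le> (norm x)\<^sup>2 - (norm (P x))\<^sup>2 + (norm ((1/3) *\<^sub>R S x))\<^sup>2 - (norm ((1/3) *\<^sub>R T x))\<^sup>2"
      unfolding third[symmetric]
      by (rule cmod_cinner_diff_le_of_pencil[OF J cscale_pencil_closed_disc[OF pencil]]) simp_all
    then show ?thesis by (simp add: norm_mult norm_divide power_divide)
  qed
  show ?thesis
    using form[where S = S1 and T = S2, OF gamma3_contractionD(2)[OF G]
        gamma3_contraction_pencil_open_disc(1)[OF J G]]
      form[where S = S2 and T = S1, OF gamma3_contractionD(1)[OF G]
        gamma3_contraction_pencil_open_disc(2)[OF J G]]
    by linarith
qed

section \<open>Factorization through a positive operator\<close>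

lemma polarization_complex_structure:
  fixes J A :: "'a::real_inner \<Rightarrow> 'a"
  assumes J: "complex_structure J" and A: "cblinear J A"
  shows "4 * inner (A x) y = inner (A (x + y)) (x + y) - inner (A (x - y)) (x - y)
    + inner (A (x - J y)) (J (x - J y)) - inner (A (x + J y)) (J (x + J y))"
  using linear_complex_structure[OF J] cblinearD(2,3)[OF A]
  by (simp add: linear_add linear_diff inner_add inner_diff complex_structure_involution[OF J]
      inner_complex_structure[OF J] inner_complex_structure_left[OF J])

context
  fixes J A D :: "'a::real_inner \<Rightarrow> 'a" and C :: real
  assumes J: "complex_structure J" and A: "cblinear J A" and D: "cblinear J D"
    and form: "\<And>x. cmod (cinner J (A x) x) \<le> C * (norm (D x))\<^sup>2"
begin

lemma abs_inner_le_sum_of_form_le: "\<bar>inner (A x) y\<bar> \<le> C * ((norm (D x))\<^sup>2 + (norm (D y))\<^sup>2)"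
proof -
  have re: "\<bar>inner (A x) x\<bar> \<le> C * (norm (D x))\<^sup>2"
    and im: "\<bar>inner (A x) (J x)\<bar> \<le> C * (norm (D x))\<^sup>2" for x
    using form[of x] abs_Re_le_cmod[of "cinner J (A x) x"] abs_Im_le_cmod[of "cinner J (A x) x"]
    by (auto simp: cinner_def)
  have parallelogram: "(norm (D (x + y)))\<^sup>2 + (norm (D (x - y)))\<^sup>2
      = 2 * (norm (D x))\<^sup>2 + 2 * (norm (D y))\<^sup>2" for x y
    using cblinearD(2)[OF D]
    by (simp add: linear_add linear_diff power2_norm_eq_inner inner_add inner_diff inner_commute)
  have "4 * \<bar>inner (A x) y\<bar> \<le> C * (norm (D (x + y)))\<^sup>2 + C * (norm (D (x - y)))\<^sup>2
      + C * (norm (D (x + J y)))\<^sup>2 + C * (norm (D (x - J y)))\<^sup>2"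
    using polarization_complex_structure[OF J A, of x y] re[of "x + y"] re[of "x - y"]
      im[of "x + J y"] im[of "x - J y"]
    by linarith
  also have "\<dots> = C * ((norm (D (x + y)))\<^sup>2 + (norm (D (x - y)))\<^sup>2)
      + C * ((norm (D (x + J y)))\<^sup>2 + (norm (D (x - J y)))\<^sup>2)"
    by (simp add: algebra_simps)
  also have "\<dots> = 4 * (C * ((norm (D x))\<^sup>2 + (norm (D y))\<^sup>2))"
    unfolding parallelogram cblinearD(3)[OF D] norm_complex_structure[OF J] by (simp add: algebra_simps)
  finally show ?thesis by simp
qed

lemma abs_inner_le_of_form_le:
  assumes C: "0 \<le> C"
  shows "\<bar>inner (A x) y\<bar> \<le> 2 * C * norm (D x) * norm (D y)"
proof (rule power2_le_imp_le)
  have "0 \<le> (C * (norm (D x))\<^sup>2) * t\<^sup>2 + inner (A x) y * t + C * (norm (D y))\<^sup>2" for t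
    using abs_inner_le_sum_of_form_le[of "t *\<^sub>R x" y]
      linear_cmul[OF cblinearD(2)[OF A]] linear_cmul[OF cblinearD(2)[OF D]]
    by (simp add: power_mult_distrib algebra_simps abs_le_iff)
  then have "(inner (A x) y)\<^sup>2 \<le> 4 * (C * (norm (D x))\<^sup>2) * (C * (norm (D y))\<^sup>2)"
    by (rule nonneg_quadratic_discriminant[rotated]) (simp add: C)
  then show "\<bar>inner (A x) y\<bar>\<^sup>2 \<le> (2 * C * norm (D x) * norm (D y))\<^sup>2"
    by (simp add: power2_eq_square ac_simps)
qed (simp add: C)

end

lemma closure_range_complex_structure:
  assumes J: "complex_structure J" and D: "cblinear J D" and v: "v \<in> closure (range D)"
  shows "J v \<in> closure (range D)"
proof -
  have "J ` closure (range D) \<subseteq> closure (range D)"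
  proof (rule image_closure_subset)
    show "continuous_on (closure (range D)) J"
      by (rule linear_continuous_on[OF bounded_linear_complex_structure[OF J]])
    show "J ` range D \<subseteq> closure (range D)"
      using closure_subset by (fastforce simp flip: cblinearD(3)[OF D])
  qed simp
  then show ?thesis using v by blast
qed

lemma form_riesz_representer:
  fixes A D :: "'a::{real_inner, complete_space} \<Rightarrow> 'a"
  assumes J: "complex_structure J" and A: "cblinear J A" and D: "cblinear J D"
    and K: "\<And>x y. \<bar>inner (A x) y\<bar> \<le> K * norm (D x) * norm (D y)" "0 \<le> K"
  obtains u where "linear u" "\<And>y. u y \<in> closure (range D)" "\<And>x y. inner (u y) (D x) = inner (A x) y"
    "\<And>y. norm (u y) \<le> K * norm (D y)" "\<And>y. u (J y) = J (u y)"
proof (rule linear_riesz_closure_range[OF cblinearD(2)[OF D],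
      of "\<lambda>y x. inner (A x) y" "\<lambda>y. K * norm (D y)"])
  show "linear (\<lambda>y. inner (A x) y)" for x
    by (rule bounded_linear.linear[OF bounded_linear_inner_right])
  show "linear (\<lambda>x. inner (A x) y)" for y
    by (rule bounded_linear.linear[OF bounded_linear_compose[OF bounded_linear_inner_left
            cblinearD(1)[OF A]]])
  show "\<bar>inner (A x) y\<bar> \<le> K * norm (D y) * norm (D x)" for x y
    using K(1)[of x y] by (simp add: ac_simps)
  fix u :: "'a \<Rightarrow> 'a"
  assume u: "linear u" "\<And>y. u y \<in> closure (range D)" "\<And>y x. inner (u y) (D x) = inner (A x) y"
    "\<And>y. norm (u y) \<le> K * norm (D y)"
  have "u (J y) = J (u y)" for y
    by (rule closure_range_eqI[where D = D])
      (simp_all add: u(2,3) closure_range_complex_structure[OF J D] inner_complex_structure_left[OF J]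
        cblinearD(3)[OF A] flip: cblinearD(3)[OF D])
  with u show ?thesis using that by blast
qed (use \<open>0 \<le> K\<close> in simp)

text \<open>The representer \<open>u y\<close> of \<open>x \<mapsto> \<langle>Ax, y\<rangle>\<close> gives rise to the representer \<open>F w\<close> of \<open>y \<mapsto> \<langle>u y, w\<rangle>\<close>, and
  \<open>\<langle>F (D x), D y\<rangle> = \<langle>u y, D x\<rangle> = \<langle>Ax, y\<rangle>\<close>.\<close>

lemma factor_through_selfadjoint:
  fixes A D :: "'a::{real_inner, complete_space} \<Rightarrow> 'a"
  assumes J: "complex_structure J" and A: "cblinear J A" and D: "cblinear J D"
    and sym: "\<And>x y. inner (D x) y = inner x (D y)"
    and K: "\<And>x y. \<bar>inner (A x) y\<bar> \<le> K * norm (D x) * norm (D y)" "0 \<le> K"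
  shows "\<exists>F. op_on J (closure (range D)) F \<and> (\<forall>x. A x = D (F (D x)))"
proof -
  obtain u where u: "linear u" "\<And>x y. inner (u y) (D x) = inner (A x) y"
    "\<And>y. norm (u y) \<le> K * norm (D y)" "\<And>y. u (J y) = J (u y)"
    by (rule form_riesz_representer[OF J A D K]) (rule that)
  obtain F where F: "linear F" "\<And>w. F w \<in> closure (range D)" "\<And>w y. inner (F w) (D y) = inner (u y) w"
    "\<And>w. norm (F w) \<le> K * norm w"
  proof (rule linear_riesz_closure_range[OF cblinearD(2)[OF D],
        of "\<lambda>w y. inner (u y) w" "\<lambda>w. K * norm w"])
    show "linear (\<lambda>w. inner (u y) w)" for y
      by (rule bounded_linear.linear[OF bounded_linear_inner_right])
    show "linear (\<lambda>y. inner (u y) w)" for w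
      by (rule linearI) (simp_all add: linear_add[OF u(1)] linear_cmul[OF u(1)] inner_add_left)
    show "\<bar>inner (u y) w\<bar> \<le> K * norm w * norm (D y)" for y w
      using Cauchy_Schwarz_ineq2[of "u y" w] mult_right_mono[OF u(3)[of y] norm_ge_zero[of w]]
      by (simp add: ac_simps)
  qed (use \<open>0 \<le> K\<close> in auto)
  have "F (J w) = J (F w)" for w
    by (rule closure_range_eqI[where D = D])
      (simp_all add: F(2,3) u(4) closure_range_complex_structure[OF J D] inner_complex_structure_left[OF J]
        flip: cblinearD(3)[OF D])
  moreover have "bounded_linear F"
    using F(4)
    by (intro bounded_linear_intro[where K = K])
      (simp_all add: linear_add[OF F(1)] linear_cmul[OF F(1)] mult.commute)
  ultimately have "op_on J (closure (range D)) F" using F(2) by (auto simp: op_on_def cblinear_def)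
  moreover have "A x = D (F (D x))" for x
    by (rule vector_eq_rdot[THEN iffD1]) (simp add: sym F(3) u(2))
  ultimately show ?thesis by blast
qed

lemma ex_factor_of_form_le:
  fixes A D :: "'a::{real_inner, complete_space} \<Rightarrow> 'a"
  assumes J: "complex_structure J" and A: "cblinear J A" and D: "positive_op J D"
    and "0 \<le> C" "\<And>x. cmod (cinner J (A x) x) \<le> C * (norm (D x))\<^sup>2"
  shows "\<exists>F. op_on J (closure (range D)) F \<and> (\<forall>x. A x = D (F (D x)))"
proof (rule factor_through_selfadjoint[OF J A positive_opD(1,2)[OF D]])
  show "\<bar>inner (A x) y\<bar> \<le> 2 * C * norm (D x) * norm (D y)" for x y
    by (rule abs_inner_le_of_form_le[OF J A positive_opD(1)[OF D] assms(5,4)])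
qed (use \<open>0 \<le> C\<close> in simp)

lemma factor_through_selfadjoint_unique:
  fixes A D F G :: "'a::real_inner \<Rightarrow> 'a"
  assumes sym: "\<And>x y. inner (D x) y = inner x (D y)"
    and F: "op_on J (closure (range D)) F" and G: "op_on J (closure (range D)) G"
    and eq: "\<And>x. A x = D (F (D x))" "\<And>x. A x = D (G (D x))" and x: "x \<in> closure (range D)"
  shows "F x = G x"
proof -
  have "F (D y) = G (D y)" for y
  proof (rule closure_range_eqI)
    show "F (D y) \<in> closure (range D)" "G (D y) \<in> closure (range D)"
      using F G closure_subset[of "range D"] by (auto simp: op_on_def)
    show "inner (F (D y)) (D w) = inner (G (D y)) (D w)" for w
      by (simp flip: sym eq)
  qed
  moreover have "closed {x. F x = G x}"
    using F G by (intro closed_Collect_eq linear_continuous_on) (simp_all add: op_on_def cblinear_def)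
  ultimately have "closure (range D) \<subseteq> {x. F x = G x}" by (intro closure_minimal) auto
  then show ?thesis using x by blast
qed

lemma numerical_radius_le:
  assumes "\<And>x. x \<in> V \<Longrightarrow> cmod (cinner J (A x) x) \<le> c * (norm x)\<^sup>2" and "0 \<le> c"
  shows "numerical_radius J V A \<le> c"
  unfolding numerical_radius_def
proof (rule cSup_least)
  fix r assume "r \<in> insert 0 {cmod (cinner J (A x) x) | x. x \<in> V \<and> norm x = 1}"
  then show "r \<le> c" using assms(1) assms(2) by force
qed simp

lemma numerical_radius_closure_range_le:
  fixes D F :: "'a::real_inner \<Rightarrow> 'a"
  assumes J: "complex_structure J" and F: "cblinear J F" and "0 \<le> c"
    and form: "\<And>x. cmod (cinner J (F (D x)) (D x)) \<le> c * (norm (D x))\<^sup>2"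
  shows "numerical_radius J (closure (range D)) F \<le> c"
proof (rule numerical_radius_le[OF _ \<open>0 \<le> c\<close>])
  have "closed {x. cmod (cinner J (F x) x) \<le> c * (norm x)\<^sup>2}"
    by (intro closed_Collect_le continuous_intros continuous_on_cinner[OF J]
        linear_continuous_on[OF cblinearD(1)[OF F]])
  then have "closure (range D) \<subseteq> {x. cmod (cinner J (F x) x) \<le> c * (norm x)\<^sup>2}"
    by (intro closure_minimal) (auto simp: form)
  then show "cmod (cinner J (F x) x) \<le> c * (norm x)\<^sup>2" if "x \<in> closure (range D)" for x
    using that by blast
qed

lemma numerical_radius_pencil_le:
  fixes D F G :: "'a::real_inner \<Rightarrow> 'a"
  assumes J: "complex_structure J" and D: "positive_op J D" and F: "cblinear J F" and G: "cblinear J G"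
    and form: "\<And>x. cmod (cinner J (D (F (D x))) x) + cmod (cinner J (D (G (D x))) x) \<le> c * (norm (D x))\<^sup>2"
    and "0 \<le> c" "cmod z \<le> 1"
  shows "numerical_radius J (closure (range D)) (\<lambda>x. F x + cscale J z (G x)) \<le> c"
proof (rule numerical_radius_closure_range_le[OF J _ \<open>0 \<le> c\<close>])
  show "cblinear J (\<lambda>x. F x + cscale J z (G x))" by (intro cblinear_add cblinear_cscale J F G)
  fix x
  have move: "cinner J y (D x) = cinner J (D y) x" for y
    using positive_opD(2)[OF D] cblinearD(3)[OF positive_opD(1)[OF D]] by (simp add: cinner_def)
  have "cmod (cinner J (F (D x) + cscale J z (G (D x))) (D x))
      \<le> cmod (cinner J (D (F (D x))) x) + cmod z * cmod (cinner J (D (G (D x))) x)"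
    unfolding cinner_add_left cinner_cscale_left[OF J] norm_mult[symmetric]
    unfolding move by (rule norm_triangle_ineq)
  also have "\<dots> \<le> cmod (cinner J (D (F (D x))) x) + cmod (cinner J (D (G (D x))) x)"
    using \<open>cmod z \<le> 1\<close> by (simp add: mult_left_le_one_le)
  also have "\<dots> \<le> c * (norm (D x))\<^sup>2" by (rule form)
  finally show "cmod (cinner J (F (D x) + cscale J z (G (D x))) (D x)) \<le> c * (norm (D x))\<^sup>2" .
qed

theorem theorem4p8:
  fixes J S1 S2 P :: "'a::{real_inner, complete_space} \<Rightarrow> 'a"
  assumes "complex_structure J"
    and "gamma3_contraction J S1 S2 P"
  shows "\<exists>F1 F2.
     op_on J (defect_space J P) F1 \<and> op_on J (defect_space J P) F2
   \<and> (\<forall>x. S1 x - adjoint S2 (P x) = defect_op J P (F1 (defect_op J P x)))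
   \<and> (\<forall>x. S2 x - adjoint S1 (P x) = defect_op J P (F2 (defect_op J P x)))
   \<and> (\<forall>G1 G2. op_on J (defect_space J P) G1 \<and> op_on J (defect_space J P) G2
        \<and> (\<forall>x. S1 x - adjoint S2 (P x) = defect_op J P (G1 (defect_op J P x)))
        \<and> (\<forall>x. S2 x - adjoint S1 (P x) = defect_op J P (G2 (defect_op J P x)))
        \<longrightarrow> (\<forall>x\<in>defect_space J P. G1 x = F1 x \<and> G2 x = F2 x))
   \<and> (\<forall>z. cmod z = 1 \<longrightarrow>
        numerical_radius J (defect_space J P) (\<lambda>x. F1 x + cscale J z (F2 x)) \<le> 3)"
proof -
  note J = assms(1) and G = assms(2)
  note S_cblinear = gamma3_contractionD[OF G] and contractive = gamma3_contraction_norm_P_le[OF J G]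
  define D where "D = defect_op J P"
  define A where "A x = S1 x - adjoint S2 (P x)" for x
  define B where "B x = S2 x - adjoint S1 (P x)" for x
  have A: "cblinear J A" and B: "cblinear J B"
    unfolding A_def[abs_def] B_def[abs_def]
    by (rule cblinear_diff[OF J] S_cblinear cblinear_compose[OF cblinear_adjoint[OF J]])+
  have D: "positive_op J D"
    unfolding D_def by (rule positive_op_defect_op[OF J S_cblinear(3) contractive])
  have form: "cmod (cinner J (A x) x) + cmod (cinner J (B x) x) \<le> 3 * (norm (D x))\<^sup>2" for x
    unfolding A_def B_def D_def norm_defect_op_power2[OF J S_cblinear(3) contractive]
    by (rule gamma3_contraction_form_le[OF J G])
  obtain F1 where F1: "op_on J (closure (range D)) F1" "\<And>x. A x = D (F1 (D x))"
    using ex_factor_of_form_le[OF J A D, of 3] order_trans[OF _ form] by auto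
  obtain F2 where F2: "op_on J (closure (range D)) F2" "\<And>x. B x = D (F2 (D x))"
    using ex_factor_of_form_le[OF J B D, of 3] order_trans[OF _ form] by auto
  have radius: "numerical_radius J (closure (range D)) (\<lambda>x. F1 x + cscale J z (F2 x)) \<le> 3"
    if "cmod z = 1" for z
    using F1 F2 form that by (intro numerical_radius_pencil_le[OF J D]) (simp_all add: op_on_def)
  note unique = factor_through_selfadjoint_unique[OF positive_opD(2)[OF D]]
  show ?thesis
    unfolding defect_space_def D_def[symmetric] A_def[symmetric] B_def[symmetric]
    using F1 F2 radius unique[OF _ F1(1) _ F1(2)] unique[OF _ F2(1) _ F2(2)]
    by (intro exI[of _ F1] exI[of _ F2]) blast
qed

end
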